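(* Let $d\in\mathbb{N}$, $\alpha\in(0,2)$, $m\ge 0$, $v>0$ and $a>0$. Suppose that $H_{m,\alpha}=L_{m,\alpha}-v\mathbf{1}_{\mathcal{B}_a}$ has a ground state $\varphi_0$. Then $\varphi_0$ is rotationally symmetric, i.e. $\varphi_0(\mathsf{R}x)=\varphi_0(x)$ for all $x\in\mathbb{R}^d$ and all rotations $\mathsf{R}\in SO(d)$.
   Context: For $z\ge 0$ let $\Phi_{m,\alpha}(z)=(z+m^{2/\alpha})^{\alpha/2}-m$, and let $L_{m,\alpha}=\Phi_{m,\alpha}(-\Delta)$ be the self-adjoint operator on $L^2(\mathbb{R}^d)$ given by the Fourier multiplier $\Phi_{m,\alpha}(|y|^2)$. $\mathcal{B}_a$ is the open ball of radius $a$ centred at $0$. A ground state of $H_{m,\alpha}$ is a nonzero $\varphi_0\in\mathrm{Dom}(H_{m,\alpha})$ with $H_{m,\alpha}\varphi_0=\lambda_0\varphi_0$, where $\lambda_0=\inf\mathrm{Spec}\,H_{m,\alpha}$. If a ground state exists it is unique up to a scalar multiple, bounded and continuous, and it is always chosen to be strictly positive with $\|\varphi_0\|_{L^2}=1$. *)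

theory Defs
  imports "HOL-Analysis.Analysis"
begin

text \<open>
  Elements of the complex Hilbert space \<open>L\<^sup>2\<close> are represented by Borel measurable square-integrable
  functions; two functions are identified when they agree almost everywhere.
\<close>

definition L2 :: "('a::euclidean_space \<Rightarrow> complex) set" where
  "L2 = {f. f \<in> borel_measurable lborel \<and> integrable lborel (\<lambda>x. (cmod (f x))\<^sup>2)}"

definition L2_norm :: "('a::euclidean_space \<Rightarrow> complex) \<Rightarrow> real" where
  "L2_norm f = sqrt (LINT x|lborel. (cmod (f x))\<^sup>2)"

definition fourier_L1 :: "('a::euclidean_space \<Rightarrow> complex) \<Rightarrow> 'a \<Rightarrow> complex" where
  "fourier_L1 f y =
     complex_of_real ((2 * pi) powr (- (real DIM('a) / 2))) * (LINT x|lborel. cis (- (x \<bullet> y)) * f x)"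

text \<open>
  \<open>is_fourier_L2 f F\<close>: the function \<open>F\<close> represents the (Plancherel) Fourier transform of \<open>f\<close>, i.e. it is
  the limit in \<open>L\<^sup>2\<close> of the transforms of the truncations of \<open>f\<close> to balls, which lie in
  \<open>L\<^sup>1 \<inter> L\<^sup>2\<close>.  The squared distance is an extended nonnegative integral, so that the convergence is
  not affected by the convention that the integral of a non-integrable function is zero.
\<close>

definition is_fourier_L2 ::
    "('a::euclidean_space \<Rightarrow> complex) \<Rightarrow> ('a \<Rightarrow> complex) \<Rightarrow> bool" where
  "is_fourier_L2 f F \<longleftrightarrow> f \<in> L2 \<and> F \<in> L2 \<and>
     (\<lambda>n. \<integral>\<^sup>+ y. ennreal ((cmod (fourier_L1 (\<lambda>x. indicator (ball 0 (real n)) x * f x) y - F y))\<^sup>2) \<partial>lborel)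
       \<longlonglongrightarrow> 0"

text \<open>
  An unbounded operator on \<open>L\<^sup>2\<close> is given by its graph, a set of pairs of representatives.
  The graph of the Fourier multiplier with symbol \<open>\<sigma>\<close> has the maximal domain
  \<open>{f \<in> L\<^sup>2. \<sigma> F \<in> L\<^sup>2}\<close>, where \<open>F\<close> is the Fourier transform of \<open>f\<close>.
\<close>

type_synonym 'a operator = "(('a \<Rightarrow> complex) \<times> ('a \<Rightarrow> complex)) set"

definition fourier_multiplier :: "('a::euclidean_space \<Rightarrow> real) \<Rightarrow> 'a operator" where
  "fourier_multiplier \<sigma> =
     {(f, g). \<exists>F. is_fourier_L2 f F \<and> is_fourier_L2 g (\<lambda>y. complex_of_real (\<sigma> y) * F y)}"

definition Phi :: "real \<Rightarrow> real \<Rightarrow> real \<Rightarrow> real" where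
  "Phi m \<alpha> z = (z + m powr (2 / \<alpha>)) powr (\<alpha> / 2) - m"

definition L_op :: "real \<Rightarrow> real \<Rightarrow> 'a::euclidean_space operator" where
  "L_op m \<alpha> = fourier_multiplier (\<lambda>y. Phi m \<alpha> ((norm y)\<^sup>2))"

text \<open>The potential is bounded, so the domain of \<open>H_op m \<alpha> v a\<close> is that of \<open>L_op m \<alpha>\<close>.\<close>

definition H_op :: "real \<Rightarrow> real \<Rightarrow> real \<Rightarrow> real \<Rightarrow> 'a::euclidean_space operator" where
  "H_op m \<alpha> v a = {(f, h). h \<in> L2 \<and> (\<exists>g. (f, g) \<in> L_op m \<alpha> \<and>
     (AE x in lborel. h x = g x - complex_of_real v * indicator (ball 0 a) x * f x))}"

text \<open>
  A point \<open>z\<close> is in the resolvent set when \<open>T - z\<close> maps the domain bijectively onto \<open>L\<^sup>2\<close> and the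
  inverse is bounded.
\<close>

definition resolvent_set :: "'a::euclidean_space operator \<Rightarrow> complex set" where
  "resolvent_set T = {z.
     (\<forall>(f, h)\<in>T. (AE x in lborel. h x - z * f x = 0) \<longrightarrow> (AE x in lborel. f x = 0)) \<and>
     (\<forall>g\<in>L2. \<exists>(f, h)\<in>T. AE x in lborel. h x - z * f x = g x) \<and>
     (\<exists>C. \<forall>(f, h)\<in>T. L2_norm f \<le> C * L2_norm (\<lambda>x. h x - z * f x))}"

definition spectrum :: "'a::euclidean_space operator \<Rightarrow> complex set" where
  "spectrum T = - resolvent_set T"

text \<open>
  Used for self-adjoint operators that are bounded below, whose spectrum is a nonempty subset of the
  real line that is bounded below.
\<close>

definition inf_spectrum :: "'a::euclidean_space operator \<Rightarrow> real" where
  "inf_spectrum T = Inf {l. complex_of_real l \<in> spectrum T}"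

definition ground_state :: "'a::euclidean_space operator \<Rightarrow> ('a \<Rightarrow> complex) \<Rightarrow> bool" where
  "ground_state T \<phi> \<longleftrightarrow> \<not> (AE x in lborel. \<phi> x = 0) \<and>
     (\<phi>, \<lambda>x. complex_of_real (inf_spectrum T) * \<phi> x) \<in> T"

text \<open>
  The chosen ground state: the continuous, strictly positive representative of norm one.
\<close>

definition normalized_ground_state ::
    "'a::euclidean_space operator \<Rightarrow> ('a \<Rightarrow> real) \<Rightarrow> bool" where
  "normalized_ground_state T \<phi> \<longleftrightarrow>
     ground_state T (\<lambda>x. complex_of_real (\<phi> x)) \<and>
     continuous_on UNIV \<phi> \<and> (\<forall>x. 0 < \<phi> x) \<and>
     L2_norm (\<lambda>x. complex_of_real (\<phi> x)) = 1"

end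

theory Submission
  imports Defs "HOL-Probability.Characteristic_Functions" "HOL-Real_Asymp.Real_Asymp"
begin

text \<open>
  Let \<open>f = \<phi>\<^sub>0 \<circ> R\<close> and \<open>g = \<phi>\<^sub>0\<close>, two positive eigenfunctions with the same eigenvalue \<open>l\<close>; only their
  proportionality has to be shown, since they agree at the origin. As \<open>Phi\<close> is a Bernstein function,
  \<open>C L f = \<integral> \<nu>(t) (f - P\<^sub>t f) dt\<close> with the heat semigroup \<open>P\<^sub>t\<close> and a density \<open>\<nu> > 0\<close>. Testing the
  equations of \<open>f\<close> and \<open>g\<close> with \<open>h g\<close> and \<open>h f\<close>, where \<open>h = f / (f + g)\<close>, and subtracting cancels the
  eigenvalue and the potential. What remains symmetrizes to
  \<open>\<integral> \<nu>(t) \<integral>\<integral> k\<^sub>t(x - y) (f(x) g(y) - g(x) f(y))\<^sup>2 / ((f + g)(x) (f + g)(y)) dx dy dt = 0\<close>,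
  so \<open>f / g\<close> is constant. To avoid Plancherel's theorem and form domains, the equations are first
  mollified by \<open>P\<^sub>s\<close>, which makes them pointwise identities; the commutator of \<open>P\<^sub>s\<close> with the potential
  tends to zero in \<open>L\<^sup>1\<close> as \<open>s \<rightarrow> 0\<close>, and Fatou's lemma gives the limit.
\<close>

section \<open>The heat kernel\<close>

text \<open>No bound on \<open>f / g\<close> is at hand, which rules out test functions built from
  that quotient, whereas \<open>h = f / (f + g)\<close> lies between 0 and 1. Its increment
  \<open>h(x) - h(y)\<close> is \<open>f(x) g(y) - g(x) f(y)\<close> divided by the product of the
  two sums, so multiplied by the antisymmetric factor \<open>f(x) g(y) - g(x) f(y)\<close> left by
  the subtraction it becomes a square. The density is singular of order
  \<open>t powr (- 1 - \<alpha> / 2)\<close> at 0, so the integral of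
  \<open>\<nu>(t) (f - P\<^sub>t f)\<close> need not converge at a given point. After mollification
  the increment from time \<open>s\<close> to time \<open>s + t\<close> is of order \<open>t\<close>
  for fixed \<open>s > 0\<close>; this gives absolute convergence and lets the integrals over
  \<open>t\<close> and \<open>x\<close> be exchanged. The price is that \<open>P\<^sub>s\<close>
  does not commute with the cutoff to the ball. The error involves only increments of
  \<open>f\<close> and \<open>g\<close> from points of the ball, and on a slightly larger ball both
  are uniformly continuous.\<close>

lemma measurable_cis [measurable (raw)]:
  "f \<in> borel_measurable M \<Longrightarrow> (\<lambda>x. cis (f x)) \<in> borel_measurable M"
  by (rule borel_measurable_continuous_on[where f = cis]) (intro continuous_intros)

lemma gaussian_fourier_real:
  fixes s t :: real
  assumes "0 < s"
  shows "integrable lborel (\<lambda>x. cis (t * x) * complex_of_real (exp (- s * x\<^sup>2)))"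
    and "(LINT x|lborel. cis (t * x) * complex_of_real (exp (- s * x\<^sup>2))) =
      complex_of_real (sqrt (pi / s) * exp (- t\<^sup>2 / (4 * s)))"
proof -
  \<comment> \<open>With \<open>c\<^sup>2 = 2 * s\<close> the standard normal density at
    \<open>c * x\<close> is a multiple of \<open>exp (- s * x\<^sup>2)\<close>, so the value comes
    from the characteristic function of the normal distribution at \<open>t / c\<close>.\<close>
  define c where "c = sqrt (2 * s)"
  have c: "c > 0" "c\<^sup>2 = 2 * s" using assms by (auto simp: c_def)
  let ?f = "\<lambda>x. iexp ((t / c) * x) * complex_of_real (std_normal_density x)"
  have int: "integrable lborel ?f"
  proof (rule Bochner_Integration.integrable_bound)
    show "integrable lborel std_normal_density" by simp
  qed (auto simp: norm_mult cis_conv_exp[symmetric] normal_density_nonneg simp del: of_real_divide of_real_mult 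
       intro!: AE_I2 simp flip: of_real_mult of_real_divide)
  have "(LINT x|lborel. ?f x) = (LINT x|std_normal_distribution. iexp ((t / c) * x))"
    by (subst integral_density) (auto simp: normal_density_nonneg scaleR_conv_of_real mult.commute)
  also have "\<dots> = complex_of_real (exp (- ((t / c)\<^sup>2) / 2))"
    using char_std_normal_distribution unfolding char_def by metis
  finally have *: "(LINT x|lborel. ?f x) = complex_of_real (exp (- ((t / c)\<^sup>2) / 2))" .
  have eq: "?f (0 + c * x) = complex_of_real (1 / sqrt (2 * pi)) * (cis (t * x) * complex_of_real (exp (- s * x\<^sup>2)))" for x
    using c assms by (simp add: normal_density_def cis_conv_exp power_mult_distrib mult_ac)
  have "integrable lborel (\<lambda>x. ?f (0 + c * x))"
    using int c by (intro lborel_integrable_real_affine) auto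
  then show "integrable lborel (\<lambda>x. cis (t * x) * complex_of_real (exp (- s * x\<^sup>2)))"
    using integrable_mult_right[where c = "complex_of_real (sqrt (2 * pi))"]
    unfolding eq by (fastforce simp flip: of_real_mult mult.assoc)
  have "complex_of_real (exp (- ((t / c)\<^sup>2) / 2)) = \<bar>c\<bar> *\<^sub>R (LINT x|lborel. ?f (0 + c * x))"
    using * lborel_integral_real_affine[of c ?f 0] c by simp
  also have "\<dots> = complex_of_real (c / sqrt (2 * pi)) * (LINT x|lborel. cis (t * x) * complex_of_real (exp (- s * x\<^sup>2)))"
    unfolding eq using c by (simp add: scaleR_conv_of_real)
  finally have "(LINT x|lborel. cis (t * x) * complex_of_real (exp (- s * x\<^sup>2))) = 
    complex_of_real (sqrt (2 * pi) / c * exp (- ((t / c)\<^sup>2) / 2))"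
    using c by (simp add: field_simps)
  also have "sqrt (2 * pi) / c = sqrt (pi / s)" by (simp add: c_def real_sqrt_divide[symmetric])
  also have "- ((t / c)\<^sup>2) / 2 = - t\<^sup>2 / (4 * s)" using c by (simp add: power_divide)
  finally show "(LINT x|lborel. cis (t * x) * complex_of_real (exp (- s * x\<^sup>2))) =
      complex_of_real (sqrt (pi / s) * exp (- t\<^sup>2 / (4 * s)))" .
qed

text \<open>Character and Gaussian both factor over the coordinates, and \<open>lborel\<close> is
  the image of the product measure over \<open>Basis\<close>; the integral is therefore a product of
  one-dimensional ones.\<close>

lemma gaussian_fourier:
  fixes x :: "'a::euclidean_space"
  assumes "0 < s"
  shows "integrable lborel (\<lambda>y::'a. cis (x \<bullet> y) * complex_of_real (exp (- s * (norm y)\<^sup>2)))" (is ?int)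
    and "(LINT y|lborel. cis (x \<bullet> y) * complex_of_real (exp (- s * (norm y)\<^sup>2))) =
      complex_of_real ((pi / s) powr (DIM('a) / 2) * exp (- (norm x)\<^sup>2 / (4 * s)))" (is ?eq)
proof -
  let ?g = "\<lambda>b z. cis ((x \<bullet> b) * z) * complex_of_real (exp (- s * z\<^sup>2))"
  have eq: "cis (x \<bullet> y) * complex_of_real (exp (- s * (norm y)\<^sup>2)) = (\<Prod>b\<in>Basis. ?g b (y \<bullet> b))" for y :: 'a
  proof -
    have "cis (x \<bullet> y) = (\<Prod>b\<in>Basis. cis ((x \<bullet> b) * (y \<bullet> b)))"
      by (subst euclidean_inner) (simp add: cis_conv_exp exp_sum sum_distrib_left)
    moreover have "exp (- s * (norm y)\<^sup>2) = (\<Prod>b\<in>Basis. exp (- s * (y \<bullet> b)\<^sup>2))"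
      by (subst power2_norm_eq_inner, subst euclidean_inner) (simp add: exp_sum[symmetric] sum_distrib_left power2_eq_square sum_negf)
    ultimately show ?thesis by (simp add: prod.distrib)
  qed
  interpret product_sigma_finite "\<lambda>_::'a. lborel :: real measure" by standard
  let ?T = "\<lambda>f. \<Sum>b\<in>Basis. f b *\<^sub>R (b::'a)"
  have T: "?T f \<bullet> b = f b" if "b \<in> Basis" for f b using that by simp
  have g: "(\<Prod>b\<in>Basis. ?g b (?T f \<bullet> b)) = (\<Prod>b\<in>Basis. ?g b (f b))" for f
    by (rule prod.cong) (auto simp: T)
  have I: "integrable (\<Pi>\<^sub>M b\<in>(Basis::'a set). lborel) (\<lambda>f. \<Prod>b\<in>Basis. ?g b (f b))"
    by (rule product_integrable_prod) (auto intro: gaussian_fourier_real[OF assms, simplified])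
  have meas: "?T \<in> (\<Pi>\<^sub>M b\<in>(Basis::'a set). lborel) \<rightarrow>\<^sub>M borel" by measurable
  have meas2: "(\<lambda>y. \<Prod>b\<in>Basis. ?g b (y \<bullet> b)) \<in> borel_measurable (borel :: 'a measure)" 
    by (intro borel_measurable_continuous_onI continuous_intros)
  show ?int
    unfolding eq by (subst lborel_eq) (use I g meas meas2 in \<open>simp add: integrable_distr_eq\<close>)
  have "(LINT y|lborel. cis (x \<bullet> y) * complex_of_real (exp (- s * (norm y)\<^sup>2))) =
     (LINT f|Pi\<^sub>M (Basis::'a set) (\<lambda>_. lborel). (\<Prod>b\<in>Basis. ?g b (f b)))"
    unfolding eq by (subst lborel_eq) (use g meas meas2 in \<open>simp add: integral_distr\<close>)
  also have "\<dots> = (\<Prod>b\<in>Basis. (LINT z|lborel. ?g b z))"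
    by (rule product_integral_prod) (auto intro: gaussian_fourier_real[OF assms, simplified])
  also have "\<dots> = (\<Prod>b\<in>(Basis::'a set). complex_of_real (sqrt (pi / s) * exp (- (x \<bullet> b)\<^sup>2 / (4 * s))))"
    by (simp only: gaussian_fourier_real(2)[OF assms])
  also have "\<dots> = complex_of_real (sqrt (pi / s) ^ DIM('a) * (\<Prod>b\<in>(Basis::'a set). exp (- (x \<bullet> b)\<^sup>2 / (4 * s))))"
    by (simp add: prod.distrib)
  also have "(\<Prod>b\<in>(Basis::'a set). exp (- (x \<bullet> b)\<^sup>2 / (4 * s))) = exp (- (norm x)\<^sup>2 / (4 * s))"
    by (subst power2_norm_eq_inner, subst euclidean_inner) (simp add: exp_sum[symmetric] sum_divide_distrib power2_eq_square sum_negf)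
  also have "sqrt (pi / s) ^ DIM('a) = (pi / s) powr (DIM('a) / 2)"
    using assms by (simp add: powr_half_sqrt[symmetric] powr_realpow[symmetric] powr_powr)
  finally show ?eq .
qed

text \<open>Time is scaled so that the generator is the Laplacian itself and not half of it: the
  symbol is \<open>exp (- s * (norm y)\<^sup>2)\<close>, which fits the argument
  \<open>(norm y)\<^sup>2\<close> of \<open>Phi\<close>.\<close>

definition heat_kernel :: "real \<Rightarrow> 'a::euclidean_space \<Rightarrow> real" where
  "heat_kernel s x = (4 * pi * s) powr (- (real DIM('a) / 2)) * exp (- (norm x)\<^sup>2 / (4 * s))"

lemma heat_kernel_pos: "0 < s \<Longrightarrow> 0 < heat_kernel s x"
  by (simp add: heat_kernel_def)

lemma heat_kernel_nonneg [simp]: "0 \<le> heat_kernel s x"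
  by (simp add: heat_kernel_def)

lemma heat_kernel_minus [simp]: "heat_kernel s (- x) = heat_kernel s x"
  by (simp add: heat_kernel_def)

lemma heat_kernel_minus_commute: "heat_kernel s (x - y) = heat_kernel s (y - x)"
  by (simp add: heat_kernel_def norm_minus_commute)

lemma measurable_heat_kernel [measurable (raw)]:
  assumes [measurable]: "f \<in> borel_measurable M" "g \<in> borel_measurable M"
  shows "(\<lambda>x. heat_kernel (f x) (g x)) \<in> borel_measurable M"
  unfolding heat_kernel_def by measurable

lemma heat_kernel_fourier:
  fixes y :: "'a::euclidean_space"
  assumes "0 < s"
  shows "integrable lborel (\<lambda>x::'a. cis (x \<bullet> y) * complex_of_real (heat_kernel s x))"
    and "(LINT x|lborel. cis (x \<bullet> y) * complex_of_real (heat_kernel s x)) = complex_of_real (exp (- s * (norm y)\<^sup>2))"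
proof -
  let ?A = "(4 * pi * s) powr (- (real DIM('a) / 2))"
  have s: "0 < 1 / (4 * s)" using assms by simp
  have eq: "cis (x \<bullet> y) * complex_of_real (heat_kernel s x) =
    complex_of_real ?A * (cis (y \<bullet> x) * complex_of_real (exp (- (1 / (4 * s)) * (norm x)\<^sup>2)))" for x
    by (simp add: heat_kernel_def inner_commute mult_ac)
  show "integrable lborel (\<lambda>x::'a. cis (x \<bullet> y) * complex_of_real (heat_kernel s x))"
    unfolding eq using gaussian_fourier(1)[OF s, of y] by simp
  have "(LINT x|lborel. cis (x \<bullet> y) * complex_of_real (heat_kernel s x)) =
    complex_of_real ?A * complex_of_real ((pi / (1 / (4 * s))) powr (DIM('a) / 2) * exp (- (norm y)\<^sup>2 / (4 * (1 / (4 * s)))))"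
    unfolding eq by (simp only: integral_mult_right_zero gaussian_fourier(2)[OF s])
  also have "\<dots> = complex_of_real ((?A * (4 * pi * s) powr (DIM('a) / 2)) * exp (- s * (norm y)\<^sup>2))"
    by (simp add: mult_ac)
  also have "?A * (4 * pi * s) powr (DIM('a) / 2) = 1"
    using assms by (simp add: powr_add[symmetric])
  finally show "(LINT x|lborel. cis (x \<bullet> y) * complex_of_real (heat_kernel s x)) = complex_of_real (exp (- s * (norm y)\<^sup>2))"
    by simp
qed

text \<open>The kernel as an integral of characters: a convolution with it can be moved to the
  Fourier side by Fubini alone, as in \<open>heat_kernel_convolution\<close> and
  \<open>heat_fourier_integrable\<close>.\<close>

lemma heat_kernel_inverse_fourier:
  fixes x :: "'a::euclidean_space"
  assumes "0 < s"
  shows "(LINT y|lborel. cis (x \<bullet> y) * complex_of_real (exp (- s * (norm y)\<^sup>2))) =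
    complex_of_real ((2 * pi) powr DIM('a) * heat_kernel s x)"
proof -
  have "(pi / s) powr (DIM('a) / 2) = (2 * pi) powr DIM('a) * (4 * pi * s) powr (- (real DIM('a) / 2))"
  proof -
    have "(2 * pi) powr DIM('a) = ((2 * pi) powr 2) powr (DIM('a) / 2)" by (subst powr_powr) (simp del: powr_numeral)
    also have "(2 * pi) powr 2 = (pi / s) * (4 * pi * s)" using assms by (simp add: power2_eq_square)
    also have "\<dots> powr (DIM('a) / 2) = (pi / s) powr (DIM('a) / 2) * (4 * pi * s) powr (DIM('a) / 2)"
      by (rule powr_mult)
    finally show ?thesis using assms by (simp add: powr_minus divide_simps)
  qed
  then show ?thesis using gaussian_fourier(2)[OF assms, of x] by (simp add: heat_kernel_def)
qed

lemma 
  assumes s: "0 < s"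
  shows integrable_heat_kernel: "integrable lborel (heat_kernel s :: 'a::euclidean_space \<Rightarrow> real)"
    and integral_heat_kernel: "(LINT x|lborel. heat_kernel s (x::'a)) = 1"
proof -
  show "integrable lborel (heat_kernel s :: 'a \<Rightarrow> real)"
    using heat_kernel_fourier(1)[OF s, of 0] by (simp add: complex_of_real_integrable_eq)
  show "(LINT x|lborel. heat_kernel s (x::'a)) = 1"
    using heat_kernel_fourier(2)[OF s, where 'a='a, of 0] by (simp add: integral_complex_of_real) 
qed

lemma nn_integral_lborel_translate:
  fixes f :: "'a::euclidean_space \<Rightarrow> ennreal"
  assumes [measurable]: "f \<in> borel_measurable borel"
  shows "(\<integral>\<^sup>+ x. f (x + c) \<partial>lborel) = (\<integral>\<^sup>+ x. f x \<partial>lborel)"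
  by (subst (2) lborel_distr_plus[of c, symmetric]) (simp add: nn_integral_distr add.commute)

lemma nn_integral_lborel_reflect:
  fixes f :: "'a::euclidean_space \<Rightarrow> ennreal"
  assumes [measurable]: "f \<in> borel_measurable borel"
  shows "(\<integral>\<^sup>+ x. f (c - x) \<partial>lborel) = (\<integral>\<^sup>+ x. f x \<partial>lborel)"
  by (subst (2) lborel_affine[of "-1" c])
    (auto simp: nn_integral_density nn_integral_distr simp flip: one_ennreal_def)

lemma nn_integral_heat_kernel:
  fixes x :: "'a::euclidean_space"
  assumes "0 < s"
  shows "(\<integral>\<^sup>+ y. ennreal (heat_kernel s (x - y)) \<partial>lborel) = 1"
    and "(\<integral>\<^sup>+ y. ennreal (heat_kernel s (y - x)) \<partial>lborel) = 1"
proof -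
  have m: "(\<lambda>y::'a. ennreal (heat_kernel s y)) \<in> borel_measurable borel" by measurable
  have "(\<integral>\<^sup>+ y. ennreal (heat_kernel s (y::'a)) \<partial>lborel) = ennreal (LINT x|lborel. heat_kernel s (x::'a))"
    using integrable_heat_kernel[OF assms] by (rule nn_integral_eq_integral) simp
  then show "(\<integral>\<^sup>+ y. ennreal (heat_kernel s (x - y)) \<partial>lborel) = 1"
    using nn_integral_lborel_reflect[OF m, of x] integral_heat_kernel[OF assms, where 'a='a] by simp
  then show "(\<integral>\<^sup>+ y. ennreal (heat_kernel s (y - x)) \<partial>lborel) = 1"
    by (simp add: heat_kernel_minus_commute)
qed

section \<open>Heat mollification and the Fourier transform\<close>

text \<open>The codomain is general because the Fourier side needs complex functions and the energy
  argument real ones.\<close>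

definition heat :: "real \<Rightarrow> ('a::euclidean_space \<Rightarrow> 'b::{banach, second_countable_topology}) \<Rightarrow> 'a \<Rightarrow> 'b" where
  "heat s f x = (LINT y|lborel. heat_kernel s (x - y) *\<^sub>R f y)"

lemma integrable_mult_square:
  fixes f g :: "'a \<Rightarrow> 'b::{real_normed_algebra, banach, second_countable_topology}"
  assumes [measurable]: "f \<in> borel_measurable M" "g \<in> borel_measurable M"
    and "integrable M (\<lambda>x. (norm (f x))\<^sup>2)" "integrable M (\<lambda>x. (norm (g x))\<^sup>2)"
  shows "integrable M (\<lambda>x. f x * g x)"
proof (rule Bochner_Integration.integrable_bound)
  show "integrable M (\<lambda>x. (norm (f x))\<^sup>2 + (norm (g x))\<^sup>2)" using assms by simp
  have "norm (f x * g x) \<le> (norm (f x))\<^sup>2 + (norm (g x))\<^sup>2" for x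
  proof -
    have "norm (f x * g x) \<le> norm (f x) * norm (g x)" by (rule norm_mult_ineq)
    also have "\<dots> \<le> 2 * norm (f x) * norm (g x)" by simp
    also have "\<dots> \<le> (norm (f x))\<^sup>2 + (norm (g x))\<^sup>2" by (rule sum_squares_bound)
    finally show ?thesis .
  qed
  then show "AE x in M. norm (f x * g x) \<le> norm ((norm (f x))\<^sup>2 + (norm (g x))\<^sup>2)" by simp
qed simp

lemma integrable_heat_kernel_diff:
  assumes "0 < s"
  shows "integrable lborel (\<lambda>y::'a::euclidean_space. heat_kernel s (x - y))"
  by (rule integrableI_nonneg) (simp_all add: nn_integral_heat_kernel[OF assms])

lemma heat_kernel_le: "0 < s \<Longrightarrow> heat_kernel s (x::'a::euclidean_space) \<le> (4 * pi * s) powr (- (real DIM('a) / 2))"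
  by (simp add: heat_kernel_def mult_left_le)

text \<open>The kernel is bounded and integrable, hence square-integrable; this makes
  \<open>heat s f x\<close> meaningful at every point for square-integrable
  \<open>f\<close>.\<close>

lemma integrable_heat_kernel_diff_square:
  fixes x :: "'a::euclidean_space"
  assumes "0 < s"
  shows "integrable lborel (\<lambda>y::'a. (heat_kernel s (x - y))\<^sup>2)"
proof (rule Bochner_Integration.integrable_bound)
  let ?K = "(4 * pi * s) powr (- (real DIM('a) / 2))"
  show "integrable lborel (\<lambda>y::'a. ?K * heat_kernel s (x - y))"
    by (intro integrable_mult_right integrable_heat_kernel_diff assms)
  show "AE y in lborel. norm ((heat_kernel s (x - y))\<^sup>2) \<le> norm (?K * heat_kernel s (x - y))"
    using heat_kernel_le[OF assms, where 'a='a] by (auto intro!: mult_right_mono simp: power2_eq_square)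
qed simp

lemma integrable_heat:
  fixes f :: "'a::euclidean_space \<Rightarrow> 'b::{banach, second_countable_topology}"
  assumes "0 < s" and [measurable]: "f \<in> borel_measurable lborel" and "integrable lborel (\<lambda>x. (norm (f x))\<^sup>2)"
  shows "integrable lborel (\<lambda>y. heat_kernel s (x - y) *\<^sub>R f y)"
proof (rule Bochner_Integration.integrable_bound)
  show "integrable lborel (\<lambda>y. heat_kernel s (x - y) * norm (f y))"
    using integrable_heat_kernel_diff_square[OF assms(1), of x] assms(3)
    by (intro integrable_mult_square) auto
qed auto

lemma integrable_gaussian:
  assumes "0 < s"
  shows "integrable lborel (\<lambda>y::'a::euclidean_space. exp (- s * (norm y)\<^sup>2))"
  using gaussian_fourier(1)[OF assms, where 'a='a, of 0] by (simp add: complex_of_real_integrable_eq)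

lemma integrable_gaussian_square:
  assumes "0 < s"
  shows "integrable lborel (\<lambda>y::'a::euclidean_space. (exp (- s * (norm y)\<^sup>2))\<^sup>2)"
  using integrable_gaussian[of "2 * s"] assms by (simp add: exp_double[symmetric] mult_ac)

text \<open>Characters have modulus one, so the double integral converges absolutely. In both
  applications \<open>g\<close> is a Gaussian, and the inner integral on the left is then a multiple
  of a heat kernel.\<close>

lemma fourier_exchange:
  fixes f g :: "'a::euclidean_space \<Rightarrow> complex"
  assumes f: "integrable lborel f" and g: "integrable lborel g"
  shows "(LINT z|lborel. (LINT y|lborel. cis ((x - z) \<bullet> y) * g y) * f z) =
    (LINT y|lborel. cis (x \<bullet> y) * g y * (LINT z|lborel. cis (- (z \<bullet> y)) * f z))"
proof -
  note [measurable] = borel_measurable_integrable[OF f] borel_measurable_integrable[OF g]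
  have "integrable (lborel \<Otimes>\<^sub>M lborel) (\<lambda>(z, y). cis ((x - z) \<bullet> y) * g y * f z)"
  proof (rule lborel_pair.Fubini_integrable)
    show "integrable lborel (\<lambda>z. LINT y|lborel. norm (case (z, y) of (z, y) \<Rightarrow> cis ((x - z) \<bullet> y) * g y * f z))"
      using f by (simp add: norm_mult)
    show "AE z in lborel. integrable lborel (\<lambda>y. case (z, y) of (z, y) \<Rightarrow> cis ((x - z) \<bullet> y) * g y * f z)"
    proof (intro AE_I2)
      fix z
      show "integrable lborel (\<lambda>y. case (z, y) of (z, y) \<Rightarrow> cis ((x - z) \<bullet> y) * g y * f z)"
        by (rule Bochner_Integration.integrable_bound[where f = "\<lambda>y. norm (g y) * norm (f z)"])
          (use g in \<open>auto simp: norm_mult\<close>)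
    qed
  qed measurable
  then have "(LINT y|lborel. LINT z|lborel. cis ((x - z) \<bullet> y) * g y * f z) =
    (LINT z|lborel. LINT y|lborel. cis ((x - z) \<bullet> y) * g y * f z)"
    by (rule lborel_pair.Fubini_integral)
  moreover have "(LINT y|lborel. cis ((x - z) \<bullet> y) * g y * f z) = (LINT y|lborel. cis ((x - z) \<bullet> y) * g y) * f z" for z
    by simp
  moreover have "(LINT z|lborel. cis ((x - z) \<bullet> y) * g y * f z) = cis (x \<bullet> y) * g y * (LINT z|lborel. cis (- (z \<bullet> y)) * f z)" for y
  proof -
    have "cis ((x - z) \<bullet> y) = cis (x \<bullet> y) * cis (- (z \<bullet> y))" for z
      by (simp add: inner_diff_left cis_mult)
    then have "cis ((x - z) \<bullet> y) * g y * f z = (cis (x \<bullet> y) * g y) * (cis (- (z \<bullet> y)) * f z)" for z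
      by (simp only: mult_ac)
    then show ?thesis by (simp only: integral_mult_right_zero)
  qed
  ultimately show ?thesis by simp
qed

text \<open>The semigroup law, read off on the Fourier side, where the Gaussian symbols multiply and
  the times add.\<close>

lemma heat_kernel_convolution:
  fixes x y :: "'a::euclidean_space"
  assumes s: "0 < s" and t: "0 < t"
  shows "(\<integral>\<^sup>+ z. ennreal (heat_kernel s (x - z) * heat_kernel t (z - y)) \<partial>lborel) = ennreal (heat_kernel (s + t) (x - y))"
proof -
  have [simp]: "(2 * pi) powr real DIM('a) \<noteq> 0" by simp
  have base: "(LINT z|lborel. heat_kernel s (u - z) * heat_kernel t z) = heat_kernel (s + t) u" for u :: 'a
  proof -
    let ?P = "complex_of_real ((2 * pi) powr real DIM('a))"
    have "?P * complex_of_real (LINT z|lborel. heat_kernel s (u - z) * heat_kernel t z) =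
      (LINT z|lborel. complex_of_real ((2 * pi) powr real DIM('a) * heat_kernel s (u - z)) * complex_of_real (heat_kernel t z))"
      by (simp add: mult_ac flip: integral_complex_of_real integral_mult_right_zero)
    also have "\<dots> = (LINT z|lborel. (LINT y|lborel. cis ((u - z) \<bullet> y) * complex_of_real (exp (- s * (norm y)\<^sup>2))) * complex_of_real (heat_kernel t z))"
      by (simp only: heat_kernel_inverse_fourier[OF s])
    also have "\<dots> = (LINT y|lborel. cis (u \<bullet> y) * complex_of_real (exp (- s * (norm y)\<^sup>2)) * 
        (LINT z|lborel. cis (- (z \<bullet> y)) * complex_of_real (heat_kernel t z)))"
      using integrable_heat_kernel[OF t, where 'a='a] integrable_gaussian[OF s, where 'a='a]
      by (intro fourier_exchange) (auto simp: complex_of_real_integrable_eq)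
    also have "\<dots> = (LINT y|lborel. cis (u \<bullet> y) * complex_of_real (exp (- (s + t) * (norm y)\<^sup>2)))"
    proof (rule Bochner_Integration.integral_cong)
      fix y :: 'a
      have "(LINT z|lborel. cis (- (z \<bullet> y)) * complex_of_real (heat_kernel t z)) = complex_of_real (exp (- t * (norm y)\<^sup>2))"
        using heat_kernel_fourier(2)[OF t, of "- y"] by simp
      then show "cis (u \<bullet> y) * complex_of_real (exp (- s * (norm y)\<^sup>2)) * 
        (LINT z|lborel. cis (- (z \<bullet> y)) * complex_of_real (heat_kernel t z)) = 
        cis (u \<bullet> y) * complex_of_real (exp (- (s + t) * (norm y)\<^sup>2))"
        by (simp add: mult_exp_exp algebra_simps flip: of_real_mult)
    qed simp
    also have "\<dots> = ?P * complex_of_real (heat_kernel (s + t) u)"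
      using heat_kernel_inverse_fourier[of "s + t" u] s t by simp
    finally show ?thesis by (simp flip: of_real_mult)
  qed
  have int: "integrable lborel (\<lambda>z::'a. heat_kernel s (u - z) * heat_kernel t z)" for u
    using integrable_heat[OF s, of "heat_kernel t" u] integrable_heat_kernel_diff_square[OF t, of 0] by simp
  have "(\<integral>\<^sup>+ z. ennreal (heat_kernel s (x - z) * heat_kernel t (z - y)) \<partial>lborel) =
     (\<integral>\<^sup>+ z. ennreal (heat_kernel s ((x - y) - z) * heat_kernel t z) \<partial>lborel)"
    by (subst nn_integral_lborel_translate[of _ "- y", symmetric]) (simp_all add: algebra_simps)
  also have "\<dots> = ennreal (heat_kernel (s + t) (x - y))"
    using int[of "x - y"] by (subst nn_integral_eq_integral) (simp_all add: base)
  finally show ?thesis .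
qed

lemma heat_fourier_integrable:
  fixes f :: "'a::euclidean_space \<Rightarrow> complex"
  assumes s: "0 < s" and f: "integrable lborel f"
  shows "heat s f x = complex_of_real ((2 * pi) powr (- (real DIM('a) / 2))) * 
    (LINT y|lborel. cis (x \<bullet> y) * complex_of_real (exp (- s * (norm y)\<^sup>2)) * fourier_L1 f y)"
proof -
  let ?c = "(2 * pi) powr (- (real DIM('a) / 2))"
  let ?P = "(2 * pi) powr real DIM('a)"
  \<comment> \<open>One factor \<open>?c\<close> belongs to \<open>fourier_L1\<close>, the other to
    the inverse transform; together they cancel the \<open>?P\<close> of
    \<open>heat_kernel_inverse_fourier\<close>.\<close>
  have cP: "?P * ?c * ?c = 1"
    by (simp flip: powr_add)
  have "complex_of_real ?P * heat s f x = (LINT z|lborel. complex_of_real (?P * heat_kernel s (x - z)) * f z)"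
    unfolding heat_def by (simp add: mult_ac scaleR_conv_of_real flip: integral_mult_right_zero)
  also have "\<dots> = (LINT z|lborel. (LINT y|lborel. cis ((x - z) \<bullet> y) * complex_of_real (exp (- s * (norm y)\<^sup>2))) * f z)"
    by (simp only: heat_kernel_inverse_fourier[OF s])
  also have "\<dots> = (LINT y|lborel. cis (x \<bullet> y) * complex_of_real (exp (- s * (norm y)\<^sup>2)) * (LINT z|lborel. cis (- (z \<bullet> y)) * f z))"
    using integrable_gaussian[OF s, where 'a='a] 
    by (intro fourier_exchange f) (auto simp: complex_of_real_integrable_eq)
  finally have *: "complex_of_real ?P * heat s f x = \<dots>" .
  have "(LINT y|lborel. cis (x \<bullet> y) * complex_of_real (exp (- s * (norm y)\<^sup>2)) * fourier_L1 f y) = 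
     complex_of_real ?c * (complex_of_real ?P * heat s f x)"
    unfolding * fourier_L1_def by (simp add: mult_ac flip: integral_mult_right_zero)
  then have "complex_of_real ?c * (LINT y|lborel. cis (x \<bullet> y) * complex_of_real (exp (- s * (norm y)\<^sup>2)) * fourier_L1 f y) = 
     complex_of_real (?P * ?c * ?c) * heat s f x" by simp
  then show ?thesis unfolding cP by simp
qed

lemma measurable_fourier_L1 [measurable]:
  fixes f :: "'a::euclidean_space \<Rightarrow> complex"
  assumes [measurable]: "f \<in> borel_measurable lborel"
  shows "fourier_L1 f \<in> borel_measurable lborel"
  unfolding fourier_L1_def by measurable

lemma norm_fourier_L1_le:
  fixes f :: "'a::euclidean_space \<Rightarrow> complex"
  shows "cmod (fourier_L1 f y) \<le> (2 * pi) powr (- (real DIM('a) / 2)) * (LINT x|lborel. cmod (f x))"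
  unfolding fourier_L1_def norm_mult
  by (rule mult_mono) (auto intro!: order_trans[OF integral_norm_bound] simp: norm_mult)

text \<open>The formula holds for the integrable truncations \<open>fn n\<close> and passes to the
  limit: on the left by dominated convergence, on the right because pairing with a Gaussian is
  continuous for the convergence of transforms that \<open>is_fourier_L2\<close> provides.\<close>

lemma heat_fourier:
  fixes f :: "'a::euclidean_space \<Rightarrow> complex"
  assumes s: "0 < s" and "is_fourier_L2 f F"
  shows "heat s f x = complex_of_real ((2 * pi) powr (- (real DIM('a) / 2))) * 
    (LINT y|lborel. cis (x \<bullet> y) * complex_of_real (exp (- s * (norm y)\<^sup>2)) * F y)"
proof -
  let ?c = "complex_of_real ((2 * pi) powr (- (real DIM('a) / 2)))"
  let ?e = "\<lambda>y. cis (x \<bullet> y) * complex_of_real (exp (- s * (norm y)\<^sup>2))"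
  from assms(2) have fm [measurable]: "f \<in> borel_measurable lborel" and f2: "integrable lborel (\<lambda>x. (cmod (f x))\<^sup>2)"
    and Fm [measurable]: "F \<in> borel_measurable lborel" and F2: "integrable lborel (\<lambda>x. (cmod (F x))\<^sup>2)"
    by (auto simp: is_fourier_L2_def L2_def)
  define fn where "fn n x = indicator (ball 0 (real n)) x * f x" for n x
  define d where "d n = (\<integral>\<^sup>+ y. ennreal ((cmod (fourier_L1 (fn n) y - F y))\<^sup>2) \<partial>lborel)" for n
  have d: "d \<longlonglongrightarrow> 0" using assms(2) unfolding is_fourier_L2_def d_def fn_def by simp
  have [measurable]: "ball (0::'a) b \<in> sets borel" for b by simp
  have fnm [measurable]: "fn n \<in> borel_measurable lborel" for n unfolding fn_def by measurable
  have fn: "integrable lborel (fn n)" for n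
    unfolding fn_def
  proof (rule integrable_mult_square)
    show "integrable lborel (\<lambda>x::'a. (cmod (indicator (ball 0 (real n)) x))\<^sup>2)"
    proof -
      have "(\<lambda>x::'a. (cmod (indicator (ball 0 (real n)) x))\<^sup>2) = indicator (ball 0 (real n))"
        by (auto simp: indicator_def)
      moreover have "emeasure lborel (ball (0::'a) (real n)) < \<infinity>"
        by (rule emeasure_bounded_finite) simp
      ultimately show ?thesis by (simp only: integrable_real_indicator borel_open open_ball sets_lborel)
    qed
  qed (use f2 in auto)
  have lim1: "(\<lambda>n. heat s (fn n) x) \<longlonglongrightarrow> heat s f x"
    unfolding heat_def
  proof (rule integral_dominated_convergence[where w = "\<lambda>y. norm (heat_kernel s (x - y) *\<^sub>R f y)"])
    show "integrable lborel (\<lambda>y. norm (heat_kernel s (x - y) *\<^sub>R f y))"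
      using integrable_heat[OF s fm f2] by (rule integrable_norm)
    show "AE y in lborel. (\<lambda>n. heat_kernel s (x - y) *\<^sub>R fn n y) \<longlonglongrightarrow> heat_kernel s (x - y) *\<^sub>R f y"
    proof (rule AE_I2)
      fix y :: 'a
      obtain N :: nat where "norm y < N" using reals_Archimedean2 by blast
      then have "\<forall>\<^sub>F n in sequentially. fn n y = f y"
        by (intro eventually_sequentiallyI[of N]) (auto simp: fn_def)
      then show "(\<lambda>n. heat_kernel s (x - y) *\<^sub>R fn n y) \<longlonglongrightarrow> heat_kernel s (x - y) *\<^sub>R f y"
        by (intro tendsto_scaleR tendsto_const tendsto_eventually)
    qed
  qed (auto simp: fn_def indicator_def)
  have e2: "integrable lborel (\<lambda>y. (cmod (?e y))\<^sup>2)"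
    using integrable_gaussian_square[OF s, where 'a='a] by (simp add: norm_mult)
  have intF: "integrable lborel (\<lambda>y. ?e y * F y)"
    by (rule integrable_mult_square[OF _ Fm e2 F2]) measurable
  have intfn: "integrable lborel (\<lambda>y. ?e y * fourier_L1 (fn n) y)" for n
  proof (rule Bochner_Integration.integrable_bound)
    let ?B = "(2 * pi) powr (- (real DIM('a) / 2)) * (LINT x|lborel. cmod (fn n x))"
    show "integrable lborel (\<lambda>y::'a. exp (- s * (norm y)\<^sup>2) * ?B)"
      using integrable_gaussian[OF s] by (rule integrable_mult_left)
    have "cmod (?e y * fourier_L1 (fn n) y) \<le> exp (- s * (norm y)\<^sup>2) * ?B" for y
      unfolding norm_mult using norm_fourier_L1_le[of "fn n" y] by (simp add: mult_left_mono)
    then show "AE y in lborel. norm (?e y * fourier_L1 (fn n) y) \<le> norm (exp (- s * (norm y)\<^sup>2) * ?B)"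
      by (auto intro: order_trans)
  qed simp
  define A where "A = (\<integral>\<^sup>+ y. (ennreal (exp (- s * (norm (y::'a))\<^sup>2)))\<^sup>2 \<partial>lborel)"
  have A: "A < top"
    using integrable_gaussian_square[OF s, where 'a='a]
    by (auto simp: A_def ennreal_power integrable_iff_bounded)
  define r where "r n = cmod ((LINT y|lborel. ?e y * fourier_L1 (fn n) y) - (LINT y|lborel. ?e y * F y))" for n
  \<comment> \<open>\<open>d\<close> tends to 0 only as a sequence of extended numbers, so the
    Cauchy-Schwarz bound stays in \<open>ennreal\<close> until the limit is taken.\<close>
  have r: "ennreal ((r n)\<^sup>2) \<le> A * d n" for n
  proof -
    have "r n = cmod (LINT y|lborel. ?e y * (fourier_L1 (fn n) y - F y))"
      unfolding r_def right_diff_distrib by (simp only: Bochner_Integration.integral_diff[OF intfn intF])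
    then have "ennreal (r n) \<le> (\<integral>\<^sup>+ y. ennreal (cmod (?e y * (fourier_L1 (fn n) y - F y))) \<partial>lborel)"
      using integral_norm_bound_ennreal[of lborel "\<lambda>y. ?e y * (fourier_L1 (fn n) y - F y)"] intfn intF
      by (simp add: right_diff_distrib)
    also have "\<dots> = (\<integral>\<^sup>+ y. ennreal (exp (- s * (norm y)\<^sup>2)) * ennreal (cmod (fourier_L1 (fn n) y - F y)) \<partial>lborel)"
      by (simp add: norm_mult ennreal_mult)
    finally have "(ennreal (r n))\<^sup>2 \<le> (\<integral>\<^sup>+ y. ennreal (exp (- s * (norm y)\<^sup>2)) * ennreal (cmod (fourier_L1 (fn n) y - F y)) \<partial>lborel)\<^sup>2"
      by (rule power_mono) simp
    also have "\<dots> \<le> A * (\<integral>\<^sup>+ y. (ennreal (cmod (fourier_L1 (fn n) y - F y)))\<^sup>2 \<partial>lborel)"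
      unfolding A_def by (rule Cauchy_Schwarz_nn_integral) measurable
    finally show ?thesis by (simp add: d_def ennreal_power r_def)
  qed
  have "(\<lambda>n. A * d n) \<longlonglongrightarrow> A * 0"
    by (rule ennreal_tendsto_cmult) (rule A, rule d)
  then have "(\<lambda>n. A * d n) \<longlonglongrightarrow> 0" by simp
  then have "(\<lambda>n. ennreal ((r n)\<^sup>2)) \<longlonglongrightarrow> ennreal 0"
    unfolding ennreal_0 by (rule tendsto_sandwich[OF _ _ tendsto_const, rotated 2]) (auto intro: always_eventually r)
  then have "(\<lambda>n. (r n)\<^sup>2) \<longlonglongrightarrow> 0" by (subst (asm) tendsto_ennreal_iff) auto
  then have "(\<lambda>n. sqrt ((r n)\<^sup>2)) \<longlonglongrightarrow> sqrt 0" by (rule tendsto_real_sqrt)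
  moreover have "0 \<le> r n" for n by (simp add: r_def)
  ultimately have "r \<longlonglongrightarrow> 0" by simp
  then have lim2: "(\<lambda>n. LINT y|lborel. ?e y * fourier_L1 (fn n) y) \<longlonglongrightarrow> (LINT y|lborel. ?e y * F y)"
    unfolding r_def by (simp add: tendsto_norm_zero_iff LIM_zero_iff)
  have "(\<lambda>n. ?c * (LINT y|lborel. ?e y * fourier_L1 (fn n) y)) \<longlonglongrightarrow> ?c * (LINT y|lborel. ?e y * F y)"
    by (intro tendsto_mult tendsto_const lim2)
  then show ?thesis
    using lim1 LIMSEQ_unique unfolding heat_fourier_integrable[OF s fn] by blast
qed

section \<open>Subordination of the symbol\<close>

text \<open>Up to a constant factor, the density of the Levy measure of the tempered
  \<alpha>/2-stable subordinator. The exponential tempering produces the shift by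
  \<open>m powr (2 / \<alpha>)\<close> in \<open>Phi\<close>.\<close>

definition levy_density :: "real \<Rightarrow> real \<Rightarrow> real \<Rightarrow> real" where
  "levy_density m \<alpha> t = (if 0 < t then exp (- (m powr (2 / \<alpha>)) * t) * t powr (- 1 - \<alpha> / 2) else 0)"

lemma levy_density_nonneg [simp]: "0 \<le> levy_density m \<alpha> t"
  by (simp add: levy_density_def)

lemma measurable_levy_density [measurable]: "levy_density m \<alpha> \<in> borel_measurable borel"
  unfolding levy_density_def by measurable

text \<open>Near 0 the factor \<open>1 - exp (- t)\<close> is at most \<open>t\<close> and leaves
  \<open>t powr (- \<beta>)\<close>, integrable for \<open>\<beta> < 1\<close>; beyond 1 it is at
  most 1 and \<open>t powr (- 1 - \<beta>)\<close> is integrable for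
  \<open>0 < \<beta>\<close>.\<close>

lemma stable_subordinator_nn_integral_finite:
  assumes "0 < \<beta>" "\<beta> < 1"
  shows "(\<integral>\<^sup>+ t. ennreal ((1 - exp (- t)) * t powr (- 1 - \<beta>)) * indicator {0<..} t \<partial>lborel) < \<infinity>"
proof -
  have "(\<integral>\<^sup>+ t. ennreal ((1 - exp (- t)) * t powr (- 1 - \<beta>)) * indicator {0<..} t \<partial>lborel) \<le>
     (\<integral>\<^sup>+ t. ennreal (t powr (- \<beta>)) * indicator {0..1} t + ennreal (t powr (- 1 - \<beta>)) * indicator {1..} t \<partial>lborel)"
  proof (rule nn_integral_mono)
    fix t :: real
    have 1: "(1 - exp (- t)) * t powr (- 1 - \<beta>) \<le> t powr (- \<beta>)" if "0 < t"
    proof -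
      have "(1 - exp (- t)) * t powr (- 1 - \<beta>) \<le> t * t powr (- 1 - \<beta>)"
        using exp_ge_add_one_self[of "- t"] by (intro mult_right_mono) auto
      also have "\<dots> = t powr (- \<beta>)" using that by (simp add: powr_diff powr_minus field_simps)
      finally show ?thesis .
    qed
    have 2: "(1 - exp (- t)) * t powr (- 1 - \<beta>) \<le> t powr (- 1 - \<beta>)" if "0 < t"
      using mult_right_mono[of "1 - exp (- t)" 1 "t powr (- 1 - \<beta>)"] by simp
    show "ennreal ((1 - exp (- t)) * t powr (- 1 - \<beta>)) * indicator {0<..} t \<le>
      ennreal (t powr (- \<beta>)) * indicator {0..1} t + ennreal (t powr (- 1 - \<beta>)) * indicator {1..} t"
      using 1 2 by (cases "t < 1") (auto simp: indicator_def ennreal_leI add_increasing)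
  qed
  also have "\<dots> = (\<integral>\<^sup>+ t. ennreal (t powr (- \<beta>)) * indicator {0..1} t \<partial>lborel) + 
      (\<integral>\<^sup>+ t. ennreal (t powr (- 1 - \<beta>)) * indicator {1..} t \<partial>lborel)"
    by (rule nn_integral_add) measurable
  also have "(\<integral>\<^sup>+ t. ennreal (t powr (- \<beta>)) * indicator {0..1} t \<partial>lborel) = ennreal (1 powr (- \<beta> + 1) / (- \<beta> + 1))"
    using assms by (intro nn_integral_has_integral_lebesgue' has_integral_powr_from_0) auto
  also have "(\<integral>\<^sup>+ t. ennreal (t powr (- 1 - \<beta>)) * indicator {1..} t \<partial>lborel) = 
    ennreal (- (1 powr ((- 1 - \<beta>) + 1)) / ((- 1 - \<beta>) + 1))"
    using assms by (intro nn_integral_has_integral_lebesgue' has_integral_powr_to_inf) auto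
  finally show ?thesis by (auto simp: ennreal_add_less_top less_top[symmetric] top_unique)
qed

text \<open>\<open>C\<close> is the value at \<open>w = 1\<close>; the substitution
  \<open>u = w * t\<close> shows that the integral is homogeneous of degree \<open>\<beta>\<close>
  in \<open>w\<close>.\<close>

lemma stable_subordinator_nn_integral:
  assumes "0 < \<beta>" "\<beta> < 1"
  obtains C where "0 < C"
    "\<And>w. 0 \<le> w \<Longrightarrow>
      (\<integral>\<^sup>+ t. ennreal ((1 - exp (- w * t)) * t powr (- 1 - \<beta>)) * indicator {0<..} t \<partial>lborel) = ennreal (C * w powr \<beta>)"
proof -
  define I where "I w = (\<integral>\<^sup>+ t. ennreal ((1 - exp (- w * t)) * t powr (- 1 - \<beta>)) * indicator {0<..} t \<partial>lborel)" for w
  have fin: "I 1 < \<infinity>" using stable_subordinator_nn_integral_finite[OF assms] by (simp add: I_def)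
  define C where "C = enn2real (I 1)"
  have IC: "I 1 = ennreal C" using fin by (simp add: C_def less_top)
  have "I 1 \<noteq> 0"
  proof
    assume "I 1 = 0"
    then have "AE t in lborel. ennreal ((1 - exp (- 1 * t)) * t powr (- 1 - \<beta>)) * indicator {0<..} t = 0"
      unfolding I_def by (subst (asm) nn_integral_0_iff_AE) measurable
    then have "AE t in lborel. t \<notin> {0<..<1::real}"
      by (rule AE_mp) (auto intro!: AE_I2 simp: indicator_def ennreal_eq_0_iff mult_le_0_iff not_le)
    then have "emeasure lborel {0<..<1::real} = 0" by (subst (asm) AE_iff_measurable[OF _ refl]) (auto simp: greaterThanLessThan_eq Int_def)
    then show False by simp
  qed
  then have "0 < C" using IC by (cases "C \<le> 0") (auto simp: ennreal_neg)
  moreover have "I w = ennreal (C * w powr \<beta>)" if "0 \<le> w" for w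
  proof (cases "w = 0")
    case True
    then show ?thesis by (simp add: I_def)
  next
    case False
    then have w: "0 < w" using that by simp
    have "I w = ennreal (1 / w) * (\<integral>\<^sup>+ u. ennreal ((1 - exp (- w * (0 + (1 / w) * u))) * (0 + (1 / w) * u) powr (- 1 - \<beta>)) * indicator {0<..} (0 + (1 / w) * u) \<partial>lborel)"
      unfolding I_def by (subst nn_integral_real_affine[where c = "1 / w" and t = 0]) (use w in auto)
    also have "(\<lambda>u. ennreal ((1 - exp (- w * (0 + (1 / w) * u))) * (0 + (1 / w) * u) powr (- 1 - \<beta>)) * indicator {0<..} (0 + (1 / w) * u)) =
      (\<lambda>u. ennreal (w powr (1 + \<beta>)) * (ennreal ((1 - exp (- 1 * u)) * u powr (- 1 - \<beta>)) * indicator {0<..} u))"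
    proof
      fix u :: real
      show "ennreal ((1 - exp (- w * (0 + (1 / w) * u))) * (0 + (1 / w) * u) powr (- 1 - \<beta>)) * indicator {0<..} (0 + (1 / w) * u) =
        ennreal (w powr (1 + \<beta>)) * (ennreal ((1 - exp (- 1 * u)) * u powr (- 1 - \<beta>)) * indicator {0<..} u)"
      proof (cases "0 < u")
        case True
        then have "(u / w) powr (- 1 - \<beta>) = w powr (1 + \<beta>) * u powr (- 1 - \<beta>)"
          using w by (simp add: powr_divide powr_minus powr_add powr_diff field_simps)
        then show ?thesis using True w by (simp add: ennreal_mult[symmetric] mult_ac)
      next
        case False
        then show ?thesis using w by (simp add: zero_less_divide_iff)
      qed
    qed
    also have "(\<integral>\<^sup>+ u. ennreal (w powr (1 + \<beta>)) * (ennreal ((1 - exp (- 1 * u)) * u powr (- 1 - \<beta>)) * indicator {0<..} u) \<partial>lborel)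
       = ennreal (w powr (1 + \<beta>)) * I 1"
      unfolding I_def by (rule nn_integral_cmult) measurable
    also have "ennreal (1 / w) * (ennreal (w powr (1 + \<beta>)) * I 1) = ennreal (C * w powr \<beta>)"
      using w \<open>0 < C\<close> unfolding IC by (simp add: ennreal_mult[symmetric] powr_add)
    finally show ?thesis .
  qed
  ultimately show ?thesis using that unfolding I_def by blast
qed

text \<open>With \<open>M = m powr (2 / \<alpha>)\<close>, the product
  \<open>exp (- M * t) * (1 - exp (- z * t))\<close> is the difference of
  \<open>1 - exp (- (z + M) * t)\<close> and \<open>1 - exp (- M * t)\<close>. The integral is thus
  a difference of two stable ones, and the second contributes
  \<open>M powr (\<alpha> / 2) = m\<close>.\<close>

lemma Phi_levy_density:
  assumes "0 < \<alpha>" "\<alpha> < 2" "0 \<le> m"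
  obtains C where "0 < C"
    "\<And>z. 0 \<le> z \<Longrightarrow>
      (\<integral>\<^sup>+ t. ennreal (levy_density m \<alpha> t * (1 - exp (- z * t))) \<partial>lborel) = ennreal (C * Phi m \<alpha> z)"
proof -
  let ?\<beta> = "\<alpha> / 2"
  define M where "M = m powr (2 / \<alpha>)"
  have M: "0 \<le> M" "M powr ?\<beta> = m" using assms by (auto simp: M_def powr_powr)
  obtain C where C: "0 < C"
    "\<And>w. 0 \<le> w \<Longrightarrow>
      (\<integral>\<^sup>+ t. ennreal ((1 - exp (- w * t)) * t powr (- 1 - ?\<beta>)) * indicator {0<..} t \<partial>lborel) = ennreal (C * w powr ?\<beta>)"
    using stable_subordinator_nn_integral[of ?\<beta>] assms by auto
  have "(\<integral>\<^sup>+ t. ennreal (levy_density m \<alpha> t * (1 - exp (- z * t))) \<partial>lborel) = ennreal (C * Phi m \<alpha> z)" if z: "0 \<le> z" for z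
  proof -
    let ?J = "\<lambda>w t. ennreal ((1 - exp (- w * t)) * t powr (- 1 - ?\<beta>)) * indicator {0<..} t"
    have "ennreal (C * (z + M) powr ?\<beta>) = (\<integral>\<^sup>+ t. ?J (z + M) t \<partial>lborel)"
      using C(2)[of "z + M"] z M by simp
    also have "\<dots> = (\<integral>\<^sup>+ t. ennreal (levy_density m \<alpha> t * (1 - exp (- z * t))) + ?J M t \<partial>lborel)"
    proof (rule nn_integral_cong)
      fix t :: real
      show "?J (z + M) t = ennreal (levy_density m \<alpha> t * (1 - exp (- z * t))) + ?J M t"
      proof (cases "0 < t")
        case True
        have "(1 - exp (- (z + M) * t)) * t powr (- 1 - ?\<beta>) = 
          exp (- M * t) * t powr (- 1 - ?\<beta>) * (1 - exp (- z * t)) + (1 - exp (- M * t)) * t powr (- 1 - ?\<beta>)"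
          by (simp add: algebra_simps exp_diff exp_minus divide_simps exp_add)
        then show ?thesis using True M z
          by (simp add: levy_density_def M_def[symmetric] ennreal_plus[symmetric] del: ennreal_plus)
      qed (simp add: levy_density_def)
    qed
    also have "\<dots> = (\<integral>\<^sup>+ t. ennreal (levy_density m \<alpha> t * (1 - exp (- z * t))) \<partial>lborel) + (\<integral>\<^sup>+ t. ?J M t \<partial>lborel)"
      by (rule nn_integral_add) measurable
    also have "(\<integral>\<^sup>+ t. ?J M t \<partial>lborel) = ennreal (C * m)" using C(2)[of M] M by simp
    finally have eq: "ennreal (C * (z + M) powr ?\<beta>) =
      (\<integral>\<^sup>+ t. ennreal (levy_density m \<alpha> t * (1 - exp (- z * t))) \<partial>lborel) + ennreal (C * m)" .
    have "(\<integral>\<^sup>+ t. ennreal (levy_density m \<alpha> t * (1 - exp (- z * t))) \<partial>lborel) = ennreal (C * (z + M) powr ?\<beta>) - ennreal (C * m)"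
      unfolding eq by simp
    also have "\<dots> = ennreal (C * Phi m \<alpha> z)"
      using assms C by (simp add: ennreal_minus Phi_def M_def right_diff_distrib)
    finally show ?thesis .
  qed
  with C(1) show ?thesis using that by blast
qed

lemma Phi_nonneg:
  assumes "0 < \<alpha>" "0 \<le> m" "0 \<le> z"
  shows "0 \<le> Phi m \<alpha> z"
proof -
  have "m = (m powr (2 / \<alpha>)) powr (\<alpha> / 2)" using assms by (simp add: powr_powr)
  also have "\<dots> \<le> (z + m powr (2 / \<alpha>)) powr (\<alpha> / 2)"
    using assms by (intro powr_mono2) auto
  finally show ?thesis by (simp add: Phi_def)
qed

text \<open>The representation of \<open>Phi\<close> at \<open>z = (norm y)\<^sup>2\<close>,
  integrated against \<open>exp (- s * (norm y)\<^sup>2) * F y\<close> times a character. Fubini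
  applies because the factor depending on \<open>t\<close> is nonnegative with integral
  \<open>C * Phi\<close>, and \<open>Phi\<close> times \<open>F\<close> is square-integrable by
  membership in the domain, hence integrable against a Gaussian.\<close>

lemma levy_equation:
  fixes f g F :: "'a::euclidean_space \<Rightarrow> complex"
  assumes par: "0 < \<alpha>" "0 \<le> m"
    and C: "0 < C" "\<And>z. 0 \<le> z \<Longrightarrow>
      (\<integral>\<^sup>+ t. ennreal (levy_density m \<alpha> t * (1 - exp (- z * t))) \<partial>lborel) = ennreal (C * Phi m \<alpha> z)"
    and f: "is_fourier_L2 f F" and g: "is_fourier_L2 g (\<lambda>y. complex_of_real (Phi m \<alpha> ((norm y)\<^sup>2)) * F y)"
    and s: "0 < s"
  shows "integrable lborel (\<lambda>t. levy_density m \<alpha> t *\<^sub>R (heat s f x - heat (s + t) f x))"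
    and "(LINT t|lborel. levy_density m \<alpha> t *\<^sub>R (heat s f x - heat (s + t) f x)) = C *\<^sub>R heat s g x"
proof -
  let ?c = "complex_of_real ((2 * pi) powr (- (real DIM('a) / 2)))"
  let ?\<nu> = "levy_density m \<alpha>"
  let ?P = "\<lambda>y::'a. Phi m \<alpha> ((norm y)\<^sup>2)"
  let ?G = "\<lambda>s y. cis (x \<bullet> y) * complex_of_real (exp (- s * (norm y)\<^sup>2)) * F y"
  let ?k = "\<lambda>t y::'a. ?\<nu> t * (1 - exp (- (norm y)\<^sup>2 * t))"
  let ?K = "\<lambda>y t. complex_of_real (?k t y) * ?G s y"
  have Fm [measurable]: "F \<in> borel_measurable lborel" and F2: "integrable lborel (\<lambda>y. (cmod (F y))\<^sup>2)"
    and PF2: "integrable lborel (\<lambda>y. (cmod (complex_of_real (?P y) * F y))\<^sup>2)"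
    using f g by (auto simp: is_fourier_L2_def L2_def)
  have Pm [measurable]: "?P \<in> borel_measurable lborel" unfolding Phi_def by measurable
  have P0: "0 \<le> ?P y" for y using par by (intro Phi_nonneg) auto
  have k0: "0 \<le> ?k t y" for t y by (cases "0 < t") (auto simp: levy_density_def)
  have e2: "integrable lborel (\<lambda>y. (cmod (cis (x \<bullet> y) * complex_of_real (exp (- s * (norm y)\<^sup>2))))\<^sup>2)" if "0 < s" for s
    using integrable_gaussian_square[OF that, where 'a='a] by (simp add: norm_mult)
  have G: "integrable lborel (?G s)" if "0 < s" for s
    by (rule integrable_mult_square[OF _ Fm e2[OF that] F2]) measurable
  have PG: "integrable lborel (\<lambda>y. complex_of_real (?P y) * ?G s y)"
  proof -
    have "integrable lborel (\<lambda>y. (cis (x \<bullet> y) * complex_of_real (exp (- s * (norm y)\<^sup>2))) * (complex_of_real (?P y) * F y))"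
      by (rule integrable_mult_square[OF _ _ e2[OF s] PF2]) measurable
    then show ?thesis by (simp add: mult_ac)
  qed
  have kint: "integrable lborel (\<lambda>t. ?k t y)" and kval: "(LINT t|lborel. ?k t y) = C * ?P y" for y
  proof -
    have nn: "(\<integral>\<^sup>+ t. ennreal (?k t y) \<partial>lborel) = ennreal (C * ?P y)" using C(2)[of "(norm y)\<^sup>2"] by simp
    show "integrable lborel (\<lambda>t. ?k t y)"
      by (rule integrableI_nonneg) (use k0 nn in auto)
    show "(LINT t|lborel. ?k t y) = C * ?P y"
      using k0 nn P0 C(1) by (subst integral_eq_nn_integral) auto
  qed
  have "integrable (lborel \<Otimes>\<^sub>M lborel) (\<lambda>(y, t). ?K y t)"
  proof (rule lborel_pair.Fubini_integrable)
    have "(\<lambda>y. LINT t|lborel. norm (case (y, t) of (y, t) \<Rightarrow> ?K y t)) = (\<lambda>y. C * norm (complex_of_real (?P y) * ?G s y))"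
    proof
      fix y
      have "norm (?K y t) = ?k t y * norm (?G s y)" for t using k0[of t y] by (simp only: norm_mult norm_of_real abs_of_nonneg)
      then show "(LINT t|lborel. norm (case (y, t) of (y, t) \<Rightarrow> ?K y t)) = C * norm (complex_of_real (?P y) * ?G s y)"
        using P0[of y] by (simp only: prod.case integral_mult_left_zero kval) (simp add: norm_mult)
    qed
    then show "integrable lborel (\<lambda>y. LINT t|lborel. norm (case (y, t) of (y, t) \<Rightarrow> ?K y t))"
      using integrable_norm[OF PG] by simp
    show "AE y in lborel. integrable lborel (\<lambda>t. case (y, t) of (y, t) \<Rightarrow> ?K y t)"
      using kint by (auto simp: complex_of_real_integrable_eq simp del: of_real_mult intro!: integrable_mult_left AE_I2)
  qed measurable
  then have Kint: "integrable lborel (\<lambda>t. LINT y|lborel. ?K y t)"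
    and swap: "(LINT t|lborel. LINT y|lborel. ?K y t) = (LINT y|lborel. LINT t|lborel. ?K y t)"
    by (rule lborel_pair.integrable_snd, rule lborel_pair.Fubini_integral)
  have inner: "levy_density m \<alpha> t *\<^sub>R (heat s f x - heat (s + t) f x) = ?c * (LINT y|lborel. ?K y t)" for t
  proof (cases "0 < t")
    case True
    have "heat s f x - heat (s + t) f x = ?c * ((LINT y|lborel. ?G s y) - (LINT y|lborel. ?G (s + t) y))"
      using heat_fourier[OF s f, of x] heat_fourier[of "s + t", OF _ f, of x] s True by (simp add: right_diff_distrib)
    also have "(LINT y|lborel. ?G s y) - (LINT y|lborel. ?G (s + t) y) = (LINT y|lborel. ?G s y - ?G (s + t) y)"
      by (intro Bochner_Integration.integral_diff[symmetric] G) (use s True in auto)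
    finally have "levy_density m \<alpha> t *\<^sub>R (heat s f x - heat (s + t) f x) = 
       ?c * (LINT y|lborel. complex_of_real (levy_density m \<alpha> t) * (?G s y - ?G (s + t) y))"
      by (simp only: scaleR_conv_of_real integral_mult_right_zero mult_ac)
    also have "(\<lambda>y. complex_of_real (levy_density m \<alpha> t) * (?G s y - ?G (s + t) y)) = (\<lambda>y. ?K y t)"
    proof
      fix y :: 'a
      have "exp (- (s + t) * (norm y)\<^sup>2) = exp (- (norm y)\<^sup>2 * t) * exp (- s * (norm y)\<^sup>2)"
        by (simp add: mult_exp_exp algebra_simps)
      then show "complex_of_real (levy_density m \<alpha> t) * (?G s y - ?G (s + t) y) = ?K y t"
        by (simp only:) (simp add: algebra_simps)
    qed
    finally show ?thesis .
  qed (simp add: levy_density_def)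
  show "integrable lborel (\<lambda>t. levy_density m \<alpha> t *\<^sub>R (heat s f x - heat (s + t) f x))"
    unfolding inner by (intro integrable_mult_right Kint)
  have "(LINT t|lborel. levy_density m \<alpha> t *\<^sub>R (heat s f x - heat (s + t) f x)) = ?c * (LINT t|lborel. LINT y|lborel. ?K y t)"
    unfolding inner by (simp only: integral_mult_right_zero)
  also have "(LINT t|lborel. LINT y|lborel. ?K y t) = (LINT y|lborel. complex_of_real (C * ?P y) * ?G s y)"
    unfolding swap by (simp only: integral_mult_left_zero integral_complex_of_real kval)
  also have "\<dots> = C *\<^sub>R (LINT y|lborel. cis (x \<bullet> y) * complex_of_real (exp (- s * (norm y)\<^sup>2)) * (complex_of_real (?P y) * F y))"
    by (simp add: scaleR_conv_of_real mult_ac flip: integral_mult_right_zero)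
  finally show "(LINT t|lborel. levy_density m \<alpha> t *\<^sub>R (heat s f x - heat (s + t) f x)) = C *\<^sub>R heat s g x" 
    using heat_fourier[OF s g, of x] by simp
qed

section \<open>The heat semigroup on nonnegative functions\<close>

text \<open>Nonnegativity allows heat averages to be computed with \<open>nn_integral\<close>, where
  integrals are exchanged without an integrability proof.\<close>

definition nonneg_L2 :: "('a::euclidean_space \<Rightarrow> real) \<Rightarrow> bool" where
  "nonneg_L2 f \<longleftrightarrow> f \<in> borel_measurable borel \<and> (\<forall>x. 0 \<le> f x) \<and> integrable lborel (\<lambda>x. (f x)\<^sup>2)"

lemma nonneg_L2D:
  assumes "nonneg_L2 f"
  shows "f \<in> borel_measurable borel" "\<And>x. 0 \<le> f x" "integrable lborel (\<lambda>x. (f x)\<^sup>2)"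
    "(\<integral>\<^sup>+ x. ennreal ((f x)\<^sup>2) \<partial>lborel) < \<infinity>"
  using assms by (auto simp: nonneg_L2_def integrable_iff_bounded)

text \<open>A crude Young inequality: \<open>f x * g y \<le> (f x)\<^sup>2 + (g y)\<^sup>2\<close>
  splits the double integral into two that decouple by translation invariance. Later estimates
  exploit that the bound is proportional to the mass of \<open>K\<close>.\<close>

lemma nn_integral_convolution_le:
  fixes f g K :: "'a::euclidean_space \<Rightarrow> real"
  assumes [measurable]: "f \<in> borel_measurable borel" "g \<in> borel_measurable borel" "K \<in> borel_measurable borel"
    and nonneg: "\<And>x. 0 \<le> K x"
  shows "(\<integral>\<^sup>+ x. \<integral>\<^sup>+ y. ennreal (f x * K (x - y) * g y) \<partial>lborel \<partial>lborel) \<le>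
    (\<integral>\<^sup>+ x. ennreal (K x) \<partial>lborel) * ((\<integral>\<^sup>+ x. ennreal ((f x)\<^sup>2) \<partial>lborel) + (\<integral>\<^sup>+ x. ennreal ((g x)\<^sup>2) \<partial>lborel))"
proof -
  have pt: "ennreal (f x * K (x - y) * g y) \<le> ennreal ((f x)\<^sup>2) * ennreal (K (x - y)) + ennreal (K (x - y)) * ennreal ((g y)\<^sup>2)" for x y
  proof -
    have "f x * g y \<le> (f x)\<^sup>2 + (g y)\<^sup>2"
      using sum_squares_bound[of "f x" "g y"] sum_squares_bound[of "f x" "- g y"] by auto
    then have "f x * K (x - y) * g y \<le> (f x)\<^sup>2 * K (x - y) + K (x - y) * (g y)\<^sup>2"
      using mult_right_mono[OF _ nonneg[of "x - y"], of "f x * g y" "(f x)\<^sup>2 + (g y)\<^sup>2"] by (simp add: algebra_simps)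
    then show ?thesis using nonneg by (simp add: ennreal_mult[symmetric] ennreal_plus[symmetric] ennreal_leI del: ennreal_plus)
  qed
  have "(\<integral>\<^sup>+ x. \<integral>\<^sup>+ y. ennreal (f x * K (x - y) * g y) \<partial>lborel \<partial>lborel) \<le>
    (\<integral>\<^sup>+ x. \<integral>\<^sup>+ y. ennreal ((f x)\<^sup>2) * ennreal (K (x - y)) + ennreal (K (x - y)) * ennreal ((g y)\<^sup>2) \<partial>lborel \<partial>lborel)"
    by (intro nn_integral_mono pt)
  also have "\<dots> = (\<integral>\<^sup>+ x. \<integral>\<^sup>+ y. ennreal ((f x)\<^sup>2) * ennreal (K (x - y)) \<partial>lborel \<partial>lborel) + 
     (\<integral>\<^sup>+ x. \<integral>\<^sup>+ y. ennreal (K (x - y)) * ennreal ((g y)\<^sup>2) \<partial>lborel \<partial>lborel)"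
    by (simp add: nn_integral_add)
  also have "(\<integral>\<^sup>+ x. \<integral>\<^sup>+ y. ennreal (K (x - y)) * ennreal ((g y)\<^sup>2) \<partial>lborel \<partial>lborel) = 
     (\<integral>\<^sup>+ y. \<integral>\<^sup>+ x. ennreal (K (x - y)) * ennreal ((g y)\<^sup>2) \<partial>lborel \<partial>lborel)"
    by (rule lborel_pair.Fubini'[symmetric]) measurable
  also have "\<dots> = (\<integral>\<^sup>+ y. (\<integral>\<^sup>+ x. ennreal (K x) \<partial>lborel) * ennreal ((g y)\<^sup>2) \<partial>lborel)"
    using nn_integral_lborel_translate[of "\<lambda>x. ennreal (K x)" "- y" for y]
    by (simp add: nn_integral_multc)
  also have "\<dots> = (\<integral>\<^sup>+ x. ennreal (K x) \<partial>lborel) * (\<integral>\<^sup>+ y. ennreal ((g y)\<^sup>2) \<partial>lborel)"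
    by (rule nn_integral_cmult) measurable
  also have "(\<integral>\<^sup>+ x. \<integral>\<^sup>+ y. ennreal ((f x)\<^sup>2) * ennreal (K (x - y)) \<partial>lborel \<partial>lborel) =
     (\<integral>\<^sup>+ x. ennreal (K x) \<partial>lborel) * (\<integral>\<^sup>+ x. ennreal ((f x)\<^sup>2) \<partial>lborel)"
    by (simp add: nn_integral_cmult nn_integral_lborel_reflect[of "\<lambda>x. ennreal (K x)"] nn_integral_multc mult.commute)
  finally show ?thesis by (simp add: distrib_left)
qed

lemma integrable_heat_real:
  assumes "0 < s" "nonneg_L2 f"
  shows "integrable lborel (\<lambda>y. heat_kernel s (x - y) * f y)"
  using integrable_heat[OF assms(1), of f x] nonneg_L2D[OF assms(2)] by simp

lemma ennreal_heat:
  assumes "0 < s" "nonneg_L2 f"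
  shows "ennreal (heat s f x) = (\<integral>\<^sup>+ y. ennreal (heat_kernel s (x - y) * f y) \<partial>lborel)"
  unfolding heat_def
  using integrable_heat_real[OF assms, of x] nonneg_L2D(2)[OF assms(2)]
  by (subst nn_integral_eq_integral) auto

lemma heat_nonneg: "nonneg_L2 f \<Longrightarrow> 0 \<le> heat s f x"
  unfolding heat_def by (auto simp: nonneg_L2_def intro!: integral_nonneg_AE)

lemma measurable_heat_pair:
  fixes f :: "'a::euclidean_space \<Rightarrow> 'b::{banach, second_countable_topology}"
  assumes [measurable]: "f \<in> borel_measurable borel" "g \<in> borel_measurable M" "h \<in> borel_measurable M"
  shows "(\<lambda>x. heat (g x) f (h x)) \<in> borel_measurable M"
  unfolding heat_def by measurable

lemma nn_integral_heat_kernel_heat: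
  assumes s: "0 < s" and t: "0 < t" and f: "nonneg_L2 f"
  shows "(\<integral>\<^sup>+ y. ennreal (heat_kernel t (x - y) * heat s f y) \<partial>lborel) = ennreal (heat (s + t) f x)"
proof -
  note [measurable] = nonneg_L2D(1)[OF f] measurable_heat_pair
  have pos: "0 \<le> f z" for z using nonneg_L2D(2)[OF f] by simp
  have conv: "(\<integral>\<^sup>+ y. ennreal (heat_kernel t (x - y)) * ennreal (heat_kernel s (y - z)) \<partial>lborel) =
      ennreal (heat_kernel (t + s) (x - z))" for z
    using heat_kernel_convolution[OF t s, of x z] by (simp add: ennreal_mult)
  have "(\<integral>\<^sup>+ y. ennreal (heat_kernel t (x - y) * heat s f y) \<partial>lborel) =
    (\<integral>\<^sup>+ y. ennreal (heat_kernel t (x - y)) * (\<integral>\<^sup>+ z. ennreal (heat_kernel s (y - z) * f z) \<partial>lborel) \<partial>lborel)"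
    using heat_nonneg[OF f] by (simp add: ennreal_mult ennreal_heat[OF s f])
  also have "\<dots> = (\<integral>\<^sup>+ y. (\<integral>\<^sup>+ z. ennreal (heat_kernel t (x - y) * heat_kernel s (y - z)) * ennreal (f z) \<partial>lborel) \<partial>lborel)"
    using pos by (simp add: nn_integral_cmult[symmetric] ennreal_mult mult_ac)
  also have "\<dots> = (\<integral>\<^sup>+ z. (\<integral>\<^sup>+ y. ennreal (heat_kernel t (x - y) * heat_kernel s (y - z)) * ennreal (f z) \<partial>lborel) \<partial>lborel)"
    by (rule lborel_pair.Fubini'[symmetric]) measurable
  also have "\<dots> = (\<integral>\<^sup>+ z. ennreal (heat_kernel (s + t) (x - z) * f z) \<partial>lborel)"
    using pos by (simp add: nn_integral_multc conv add.commute ennreal_mult)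
  also have "\<dots> = ennreal (heat (s + t) f x)"
    using s t by (intro ennreal_heat[symmetric] f) simp
  finally show ?thesis .
qed

lemma heat_heat:
  assumes s: "0 < s" and t: "0 < t" and f: "nonneg_L2 f"
  shows "heat t (heat s f) x = heat (s + t) f x"
proof -
  note [measurable] = nonneg_L2D(1)[OF f] measurable_heat_pair
  have "heat t (heat s f) x = enn2real (\<integral>\<^sup>+ y. ennreal (heat_kernel t (x - y) * heat s f y) \<partial>lborel)"
    unfolding heat_def[of t] real_scaleR_def
    by (rule integral_eq_nn_integral) (auto intro!: AE_I2 mult_nonneg_nonneg heat_nonneg f)
  then show ?thesis using heat_nonneg[OF f] by (simp add: nn_integral_heat_kernel_heat[OF s t f])
qed

text \<open>By symmetry of the kernel and the semigroup law, the squared norm of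
  \<open>heat s f\<close> is the pairing of \<open>f\<close> with \<open>heat (s + s) f\<close>,
  which the convolution estimate bounds.\<close>

lemma nonneg_L2_heat:
  assumes s: "0 < s" and f: "nonneg_L2 f"
  shows "nonneg_L2 (heat s f)"
proof -
  note [measurable] = nonneg_L2D(1)[OF f] measurable_heat_pair
  have pos: "0 \<le> f z" for z using nonneg_L2D(2)[OF f] by simp
  let ?p = "heat s f"
  have "(\<integral>\<^sup>+ x. ennreal ((?p x)\<^sup>2) \<partial>lborel) = (\<integral>\<^sup>+ x. ennreal (?p x) * (\<integral>\<^sup>+ y. ennreal (heat_kernel s (x - y) * f y) \<partial>lborel) \<partial>lborel)"
    using heat_nonneg[OF f] by (simp add: power2_eq_square ennreal_mult ennreal_heat[OF s f])
  also have "\<dots> = (\<integral>\<^sup>+ x. (\<integral>\<^sup>+ y. ennreal (f y) * ennreal (heat_kernel s (y - x) * ?p x) \<partial>lborel) \<partial>lborel)"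
    using pos heat_nonneg[OF f] by (simp add: nn_integral_cmult[symmetric] ennreal_mult mult_ac heat_kernel_minus_commute)
  also have "\<dots> = (\<integral>\<^sup>+ y. (\<integral>\<^sup>+ x. ennreal (f y) * ennreal (heat_kernel s (y - x) * ?p x) \<partial>lborel) \<partial>lborel)"
    by (rule lborel_pair.Fubini'[symmetric]) measurable
  also have "\<dots> = (\<integral>\<^sup>+ y. ennreal (f y) * (\<integral>\<^sup>+ x. ennreal (heat_kernel s (y - x) * ?p x) \<partial>lborel) \<partial>lborel)"
    by (simp add: nn_integral_cmult)
  also have "\<dots> = (\<integral>\<^sup>+ y. \<integral>\<^sup>+ x. ennreal (f y * heat_kernel (s + s) (y - x) * f x) \<partial>lborel \<partial>lborel)"
  proof (intro nn_integral_cong)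
    fix y
    show "ennreal (f y) * (\<integral>\<^sup>+ x. ennreal (heat_kernel s (y - x) * ?p x) \<partial>lborel) = 
       (\<integral>\<^sup>+ x. ennreal (f y * heat_kernel (s + s) (y - x) * f x) \<partial>lborel)"
      unfolding nn_integral_heat_kernel_heat[OF s s f]
      using s f pos by (simp add: ennreal_heat nn_integral_cmult[symmetric] ennreal_mult mult_ac)
  qed
  also have "\<dots> \<le> (\<integral>\<^sup>+ x. ennreal (heat_kernel (s + s) (x::'a)) \<partial>lborel) * 
      ((\<integral>\<^sup>+ x. ennreal ((f x)\<^sup>2) \<partial>lborel) + (\<integral>\<^sup>+ x. ennreal ((f x)\<^sup>2) \<partial>lborel))"
    by (rule nn_integral_convolution_le) measurable
  also have "\<dots> < \<infinity>"
    using nonneg_L2D(4)[OF f] nn_integral_heat_kernel(2)[of "s + s" "0::'a"] s by simp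
  finally have "integrable lborel (\<lambda>x. (?p x)\<^sup>2)"
    by (intro integrableI_bounded) auto
  then show ?thesis using heat_nonneg[OF f] by (auto simp: nonneg_L2_def)
qed

text \<open>In passing from \<open>s\<close> to \<open>s + t\<close> only the prefactor decreases,
  by \<open>(1 + t / s) powr (- (real DIM('a) / 2))\<close>, which is at least \<open>c\<close>
  because \<open>1 + t / s \<le> exp (t / s)\<close>. Hence the difference is dominated by (new
  kernel - \<open>c\<close> * old kernel) + (1 - \<open>c\<close>) * (old kernel), and each summand
  has integral \<open>1 - c\<close>. The exponential form of \<open>c\<close> makes the bound
  integrable against the Levy density.\<close>

lemma heat_kernel_time_diff:
  assumes s: "0 < s" and t: "0 < t"
  shows "(\<integral>\<^sup>+ x. ennreal \<bar>heat_kernel (s + t) (x::'a::euclidean_space) - heat_kernel s x\<bar> \<partial>lborel) \<le> 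
    ennreal (2 * (1 - exp (- (real DIM('a) / (2 * s)) * t)))"
proof -
  define c where "c = exp (- (real DIM('a) / (2 * s)) * t)"
  have c: "0 \<le> c" "c \<le> 1" using assms by (auto simp: c_def)
  have low: "c * heat_kernel s x \<le> heat_kernel (s + t) x" for x :: 'a
  proof -
    have "1 + t / s \<le> exp (t / s)" using s t by (intro exp_ge_add_one_self_aux) auto
    then have "(exp (t / s)) powr (- (real DIM('a) / 2)) \<le> (1 + t / s) powr (- (real DIM('a) / 2))"
      using s t by (intro powr_mono2') (auto intro: add_pos_pos)
    then have "c \<le> (1 + t / s) powr (- (real DIM('a) / 2))"
      by (simp add: c_def powr_def)
    then have "c * (4 * pi * s) powr (- (real DIM('a) / 2)) \<le> (1 + t / s) powr (- (real DIM('a) / 2)) * (4 * pi * s) powr (- (real DIM('a) / 2))"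
      by (rule mult_right_mono) simp
    also have "\<dots> = ((1 + t / s) * (4 * pi * s)) powr (- (real DIM('a) / 2))"
      by (rule powr_mult[symmetric])
    also have "(1 + t / s) * (4 * pi * s) = 4 * pi * (s + t)" using s by (simp add: field_simps)
    finally have 1: "c * (4 * pi * s) powr (- (real DIM('a) / 2)) \<le> (4 * pi * (s + t)) powr (- (real DIM('a) / 2))" .
    have 2: "exp (- (norm x)\<^sup>2 / (4 * s)) \<le> exp (- (norm x)\<^sup>2 / (4 * (s + t)))"
      using s t by (simp add: divide_left_mono)
    show ?thesis using mult_mono[OF 1 2] by (simp add: heat_kernel_def mult_ac)
  qed
  have "(\<integral>\<^sup>+ x. ennreal \<bar>heat_kernel (s + t) (x::'a) - heat_kernel s x\<bar> \<partial>lborel) \<le>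
     (\<integral>\<^sup>+ x. ennreal (heat_kernel (s + t) (x::'a) + (1 - 2 * c) * heat_kernel s x) \<partial>lborel)"
  proof (intro nn_integral_mono ennreal_leI)
    fix x :: 'a
    have "c * heat_kernel s x \<le> 1 * heat_kernel s x" using c by (intro mult_right_mono) auto
    then show "\<bar>heat_kernel (s + t) x - heat_kernel s x\<bar> \<le> heat_kernel (s + t) x + (1 - 2 * c) * heat_kernel s x"
      using low[of x] by (auto simp: algebra_simps abs_le_iff)
  qed
  also have "\<dots> = ennreal (LINT x|lborel. heat_kernel (s + t) (x::'a) + (1 - 2 * c) * heat_kernel s x)"
  proof (rule nn_integral_eq_integral)
    show "integrable lborel (\<lambda>x::'a. heat_kernel (s + t) x + (1 - 2 * c) * heat_kernel s x)"
      using s t by (simp add: integrable_heat_kernel)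
    have "0 \<le> heat_kernel (s + t) x + (1 - 2 * c) * heat_kernel s x" for x :: 'a
    proof -
      have "c * heat_kernel s x \<le> 1 * heat_kernel s x" using c by (intro mult_right_mono) auto
      then show ?thesis using low[of x] by (simp add: algebra_simps)
    qed
    then show "AE x in lborel. 0 \<le> heat_kernel (s + t) (x::'a) + (1 - 2 * c) * heat_kernel s x" by simp
  qed
  also have "(LINT x|lborel. heat_kernel (s + t) (x::'a) + (1 - 2 * c) * heat_kernel s x) = 1 + (1 - 2 * c) * 1"
    using s t by (simp add: integrable_heat_kernel integral_heat_kernel)
  finally show ?thesis by (simp add: c_def)
qed

section \<open>The heat kernel as an approximate identity\<close>

lemma gaussian_tail_limit:
  fixes c p A B N :: real
  assumes "0 < c" "0 < p"
  shows "((\<lambda>s. A * exp (- c / s) * (B + (8 * pi * s) powr (- p) * N)) \<longlongrightarrow> 0) (at_right 0)"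
proof -
  have "((\<lambda>s. exp (- c / s)) \<longlongrightarrow> 0) (at_right 0)"
    using assms(1) by real_asymp
  moreover have "((\<lambda>s. exp (- c / s) * (8 * pi * s) powr (- p)) \<longlongrightarrow> 0) (at_right 0)"
    using assms pi_gt_zero by real_asymp
  ultimately have "((\<lambda>s. A * B * exp (- c / s) + A * N * (exp (- c / s) * (8 * pi * s) powr (- p))) \<longlongrightarrow> A * B * 0 + A * N * 0) (at_right 0)"
    by (intro tendsto_intros)
  then show ?thesis by (simp add: algebra_simps)
qed

text \<open>Half of the exponent gives the decay in \<open>\<delta>\<close>, the other half is the
  exponent of the kernel at time \<open>2 * s\<close>; the power of 2 is the quotient of the two
  prefactors.\<close>

lemma heat_kernel_tail:
  fixes u :: "'a::euclidean_space"
  assumes s: "0 < s" and \<delta>: "0 \<le> \<delta>" "\<delta> \<le> norm u"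
  shows "heat_kernel s u \<le> 2 powr (DIM('a) / 2) * exp (- (\<delta>\<^sup>2 / 8) / s) * heat_kernel (2 * s) u"
proof -
  have "4 * pi * s = 1 / 2 * (8 * pi * s)" by simp
  then have "(4 * pi * s) powr (- (real DIM('a) / 2)) = (1 / 2 * (8 * pi * s)) powr (- (real DIM('a) / 2))"
    by (simp only:)
  also have "\<dots> = (1 / 2) powr (- (real DIM('a) / 2)) * (8 * pi * s) powr (- (real DIM('a) / 2))"
    by (rule powr_mult)
  also have "(1 / 2) powr (- (real DIM('a) / 2)) = 2 powr (DIM('a) / 2)"
    by (simp add: powr_divide powr_minus field_simps)
  finally have 1: "(4 * pi * s) powr (- (real DIM('a) / 2)) = 2 powr (DIM('a) / 2) * (8 * pi * s) powr (- (real DIM('a) / 2))" .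
  have "\<delta>\<^sup>2 \<le> (norm u)\<^sup>2" using \<delta> by (intro power_mono)
  then have "- (norm u)\<^sup>2 / (4 * s) \<le> - (\<delta>\<^sup>2 / 8) / s + (- (norm u)\<^sup>2 / (8 * s))"
    using s by (simp add: divide_simps)
  then have 2: "exp (- (norm u)\<^sup>2 / (4 * s)) \<le> exp (- (\<delta>\<^sup>2 / 8) / s) * exp (- (norm u)\<^sup>2 / (8 * s))"
    by (simp flip: exp_add)
  show ?thesis unfolding heat_kernel_def 1
    using mult_left_mono[OF 2, of "2 powr (DIM('a) / 2) * (8 * pi * s) powr (- (real DIM('a) / 2))"]
    by (simp add: mult_ac)
qed

text \<open>Close to \<open>z\<close> uniform continuity on a compact ball applies. Far from
  \<open>z\<close> the function is controlled only through its square, by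
  \<open>f y \<le> (f y)\<^sup>2 + 1\<close>, and the Gaussian tail outweighs the growing prefactor.
  The absolute value stands inside the integral because the commutator estimate needs it
  there.\<close>

lemma heat_kernel_approx_uniform:
  fixes f :: "'a::euclidean_space \<Rightarrow> real"
  assumes cont: "continuous_on UNIV f" and f: "nonneg_L2 f" and \<epsilon>: "0 < \<epsilon>"
  shows "\<forall>\<^sub>F s in at_right 0. \<forall>z\<in>cball 0 a. (\<integral>\<^sup>+ y. ennreal (heat_kernel s (z - y) * \<bar>f y - f z\<bar>) \<partial>lborel) \<le> ennreal \<epsilon>"
proof -
  note [measurable] = nonneg_L2D(1)[OF f]
  have pos: "0 \<le> f z" for z using nonneg_L2D(2)[OF f] by simp
  define N where "N = (LINT x|lborel. (f x)\<^sup>2)"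
  have "uniformly_continuous_on (cball 0 (a + 1)) f"
    using cont by (intro compact_uniformly_continuous) (auto intro: continuous_on_subset)
  then obtain d where d: "d > 0" "\<And>x y. x \<in> cball 0 (a + 1) \<Longrightarrow> y \<in> cball 0 (a + 1) \<Longrightarrow> dist y x < d \<Longrightarrow> dist (f y) (f x) < \<epsilon> / 2"
    using \<epsilon> unfolding uniformly_continuous_on_def by (metis half_gt_zero)
  \<comment> \<open>The bound by 1 keeps points within \<open>\<delta>\<close> of
    \<open>cball 0 a\<close> inside \<open>cball 0 (a + 1)\<close>.\<close>
  define \<delta> where "\<delta> = min d 1"
  have \<delta>: "0 < \<delta>" using d by (simp add: \<delta>_def)
  have near: "\<bar>f y - f z\<bar> \<le> \<epsilon> / 2" if "z \<in> cball 0 a" "norm (z - y) < \<delta>" for y z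
  proof -
    have "norm y \<le> norm z + norm (z - y)" by norm
    then have "y \<in> cball 0 (a + 1)" using that by (simp add: \<delta>_def)
    moreover have "z \<in> cball 0 (a + 1)" using that by simp
    ultimately show ?thesis using d(2)[of z y] that by (simp add: \<delta>_def dist_norm norm_minus_commute)
  qed
  have "compact (f ` cball 0 a)"
    using cont by (intro compact_continuous_image) (auto intro: continuous_on_subset)
  then obtain M where M: "\<And>z. z \<in> cball 0 a \<Longrightarrow> f z \<le> M"
    using compact_imp_bounded bounded_imp_bdd_above by (metis bdd_above.unfold image_eqI)
  \<comment> \<open>\<open>?\<eta> s\<close> is the factor in \<open>heat_kernel_tail\<close>, and
    \<open>?k2 s\<close> is the supremum of the kernel at time \<open>2 * s\<close>, whence
    \<open>8 * pi * s\<close>.\<close>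
  let ?\<eta> = "\<lambda>s. 2 powr (DIM('a) / 2) * exp (- (\<delta>\<^sup>2 / 8) / s)"
  let ?k2 = "\<lambda>s. (8 * pi * s) powr (- (real DIM('a) / 2))"
  have "((\<lambda>s. ?\<eta> s * ((1 + M) + ?k2 s * N)) \<longlongrightarrow> 0) (at_right 0)"
    using \<delta> by (intro gaussian_tail_limit) auto
  then have "\<forall>\<^sub>F s in at_right 0. ?\<eta> s * ((1 + M) + ?k2 s * N) < \<epsilon> / 2"
    using \<epsilon> by (intro order_tendstoD) auto
  moreover have "\<forall>\<^sub>F s in at_right (0::real). 0 < s" by (simp add: eventually_at_right_less)
  ultimately show ?thesis
  proof eventually_elim
    case (elim s)
    have s: "0 < s" and s2: "0 < 2 * s" using elim by auto
    show ?case
    proof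
      fix z :: 'a assume z: "z \<in> cball 0 a"
      \<comment> \<open>A common majorant: the first summand serves the points near
        \<open>z\<close>, the other two the far ones. As the kernels have mass 1, its integral is
        \<open>\<epsilon> / 2\<close> plus the quantity just made smaller than
        \<open>\<epsilon> / 2\<close>.\<close>
      let ?B = "\<lambda>y. \<epsilon> / 2 * heat_kernel s (z - y) + (?\<eta> s * (1 + M) * heat_kernel (2 * s) (z - y) + ?\<eta> s * ?k2 s * (f y)\<^sup>2)"
      have M0: "0 \<le> 1 + M" using M[OF z] pos[of z] by simp
      have B0: "0 \<le> ?B y" for y
        using \<epsilon> M0 by (auto intro!: add_nonneg_nonneg mult_nonneg_nonneg)
      have "(\<integral>\<^sup>+ y. ennreal (heat_kernel s (z - y) * \<bar>f y - f z\<bar>) \<partial>lborel) \<le> (\<integral>\<^sup>+ y. ennreal (?B y) \<partial>lborel)"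
      proof (intro nn_integral_mono ennreal_leI)
        fix y
        show "heat_kernel s (z - y) * \<bar>f y - f z\<bar> \<le> ?B y"
        proof (cases "norm (z - y) < \<delta>")
          case True
          have "heat_kernel s (z - y) * \<bar>f y - f z\<bar> \<le> heat_kernel s (z - y) * (\<epsilon> / 2)"
            using near[OF z True] by (intro mult_left_mono) auto
          also have "\<dots> \<le> ?B y" using M0 by (simp add: mult.commute)
          finally show ?thesis .
        next
          case False
          have "\<bar>f y - f z\<bar> \<le> f y + f z" using pos[of y] pos[of z] by simp
          also have "f y \<le> (f y)\<^sup>2 + 1" using sum_squares_bound[of "f y" 1] pos[of y] by simp
          also have "f z \<le> M" using M[OF z] .
          finally have 1: "\<bar>f y - f z\<bar> \<le> (1 + M) + (f y)\<^sup>2" by simp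
          have 2: "heat_kernel s (z - y) \<le> ?\<eta> s * heat_kernel (2 * s) (z - y)"
            using False s \<delta> by (intro heat_kernel_tail) auto
          have 3: "heat_kernel (2 * s) (z - y) \<le> ?k2 s"
            using heat_kernel_le[OF s2, of "z - y"] by (simp add: mult_ac)
          have "heat_kernel s (z - y) * \<bar>f y - f z\<bar> \<le> (?\<eta> s * heat_kernel (2 * s) (z - y)) * ((1 + M) + (f y)\<^sup>2)"
            using 1 2 by (intro mult_mono) auto
          also have "\<dots> = ?\<eta> s * (1 + M) * heat_kernel (2 * s) (z - y) + ?\<eta> s * heat_kernel (2 * s) (z - y) * (f y)\<^sup>2"
            by (simp add: algebra_simps)
          also have "?\<eta> s * heat_kernel (2 * s) (z - y) * (f y)\<^sup>2 \<le> ?\<eta> s * ?k2 s * (f y)\<^sup>2"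
            using 3 by (intro mult_right_mono mult_left_mono) auto
          finally have "heat_kernel s (z - y) * \<bar>f y - f z\<bar> \<le>
            ?\<eta> s * (1 + M) * heat_kernel (2 * s) (z - y) + ?\<eta> s * ?k2 s * (f y)\<^sup>2" by simp
          moreover have "0 \<le> \<epsilon> / 2 * heat_kernel s (z - y)" using \<epsilon> by simp
          ultimately show ?thesis by linarith
        qed
      qed
      also have "\<dots> = ennreal (LINT y|lborel. ?B y)"
      proof (rule nn_integral_eq_integral)
        show "integrable lborel ?B"
          by (intro Bochner_Integration.integrable_add integrable_mult_right integrable_heat_kernel_diff nonneg_L2D(3)[OF f] s s2)
      qed (use B0 in auto)
      also have "(LINT y|lborel. ?B y) = \<epsilon> / 2 * (LINT y|lborel. heat_kernel s (z - y)) + 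
          (?\<eta> s * (1 + M) * (LINT y|lborel. heat_kernel (2 * s) (z - y)) + ?\<eta> s * ?k2 s * N)"
        using nonneg_L2D(3)[OF f] s by (simp add: integrable_heat_kernel_diff N_def)
      also have "(LINT y|lborel. heat_kernel s (z - y)) = 1"
        using s nn_integral_heat_kernel(1)[OF s, of z] by (subst integral_eq_nn_integral) auto
      also have "(LINT y|lborel. heat_kernel (2 * s) (z - y)) = 1"
        using nn_integral_heat_kernel(1)[OF s2, of z] by (subst integral_eq_nn_integral) auto
      finally show "(\<integral>\<^sup>+ y. ennreal (heat_kernel s (z - y) * \<bar>f y - f z\<bar>) \<partial>lborel) \<le> ennreal \<epsilon>"
        using elim by (elim order_trans) (auto intro!: ennreal_leI simp: algebra_simps)
    qed
  qed
qed

lemma heat_minus_const_le: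
  assumes s: "0 < s" and f: "nonneg_L2 f"
  shows "ennreal \<bar>heat s f x - c\<bar> \<le> (\<integral>\<^sup>+ y. ennreal (heat_kernel s (x - y) * \<bar>f y - c\<bar>) \<partial>lborel)"
proof -
  have int: "integrable lborel (\<lambda>y. heat_kernel s (x - y) * (f y - c))"
    using integrable_heat_real[OF s f, of x] integrable_heat_kernel_diff[OF s, of x] by (simp add: right_diff_distrib)
  have "(LINT y|lborel. heat_kernel s (x - y)) = 1"
    using s nn_integral_heat_kernel(1)[OF s, of x] by (subst integral_eq_nn_integral) auto
  then have "heat s f x - c = (LINT y|lborel. heat_kernel s (x - y) * f y) - (LINT y|lborel. heat_kernel s (x - y)) * c"
    by (simp add: heat_def)
  also have "\<dots> = (LINT y|lborel. heat_kernel s (x - y) * (f y - c))"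
    using integrable_heat_real[OF s f, of x] integrable_heat_kernel_diff[OF s, of x] by (simp add: right_diff_distrib)
  finally show ?thesis
    using integral_norm_bound_ennreal[OF int] by (simp add: abs_mult)
qed

lemma heat_tendsto:
  fixes f :: "'a::euclidean_space \<Rightarrow> real"
  assumes cont: "continuous_on UNIV f" and f: "nonneg_L2 f"
  shows "((\<lambda>s. heat s f x) \<longlongrightarrow> f x) (at_right 0)"
proof (rule tendstoI)
  fix \<epsilon> :: real assume "0 < \<epsilon>"
  then have "\<forall>\<^sub>F s in at_right 0. \<forall>z\<in>cball 0 (norm x). (\<integral>\<^sup>+ y. ennreal (heat_kernel s (z - y) * \<bar>f y - f z\<bar>) \<partial>lborel) \<le> ennreal (\<epsilon> / 2)"
    by (intro heat_kernel_approx_uniform assms) simp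
  moreover have "\<forall>\<^sub>F s in at_right (0::real). 0 < s" by (simp add: eventually_at_right_less)
  ultimately show "\<forall>\<^sub>F s in at_right 0. dist (heat s f x) (f x) < \<epsilon>"
  proof eventually_elim
    case (elim s)
    then have "ennreal \<bar>heat s f x - f x\<bar> \<le> ennreal (\<epsilon> / 2)"
      using heat_minus_const_le[OF _ f, of s x "f x"] by (auto intro: order_trans)
    then show ?case using \<open>0 < \<epsilon>\<close> by (simp add: dist_real_def)
  qed
qed

section \<open>The commutator of the heat semigroup with the potential\<close>

lemma nonneg_L2_indicator:
  assumes "nonneg_L2 f" and [measurable]: "B \<in> sets borel"
  shows "nonneg_L2 (\<lambda>z. indicator B z * f z)"
proof -
  note [measurable] = nonneg_L2D(1)[OF assms(1)]
  have "integrable lborel (\<lambda>z. (indicator B z * f z)\<^sup>2)"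
    by (rule Bochner_Integration.integrable_bound[OF nonneg_L2D(3)[OF assms(1)]]) (auto simp: indicator_def)
  then show ?thesis using nonneg_L2D(2)[OF assms(1)] by (simp add: nonneg_L2_def)
qed

text \<open>The left-hand integrand is an average over \<open>z\<close> in \<open>B\<close> of
  \<open>heat s g x * f z - heat s f x * g z\<close>, an expression that would vanish if the heat
  averages were replaced by \<open>g z\<close> and \<open>f z\<close>. So only increments from
  points of \<open>B\<close> remain, and integrating over \<open>x\<close> merges the two kernels
  into the one at time \<open>2 * s\<close>.\<close>

lemma commutator_le:
  fixes f g :: "'a::euclidean_space \<Rightarrow> real"
  assumes s: "0 < s" and f: "nonneg_L2 f" and g: "nonneg_L2 g" and [measurable]: "B \<in> sets borel"
  shows "(\<integral>\<^sup>+ x. ennreal \<bar>heat s g x * heat s (\<lambda>z. indicator B z * f z) x - heat s f x * heat s (\<lambda>z. indicator B z * g z) x\<bar> \<partial>lborel) \<le>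
    (\<integral>\<^sup>+ z. indicator B z * (ennreal (f z) * (\<integral>\<^sup>+ y. ennreal (heat_kernel (2 * s) (z - y) * \<bar>g y - g z\<bar>) \<partial>lborel) +
      ennreal (g z) * (\<integral>\<^sup>+ y. ennreal (heat_kernel (2 * s) (z - y) * \<bar>f y - f z\<bar>) \<partial>lborel)) \<partial>lborel)"
proof -
  note [measurable] = nonneg_L2D(1)[OF f] nonneg_L2D(1)[OF g] measurable_heat_pair
  note Bf = nonneg_L2_indicator[OF f \<open>B \<in> sets borel\<close>] and Bg = nonneg_L2_indicator[OF g \<open>B \<in> sets borel\<close>]
  have f0: "0 \<le> f z" and g0: "0 \<le> g z" for z using nonneg_L2D(2)[OF f] nonneg_L2D(2)[OF g] by auto
  let ?p = "heat s f" and ?q = "heat s g"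
  let ?Q = "\<lambda>z y. ennreal (f z) * ennreal \<bar>g y - g z\<bar> + ennreal (g z) * ennreal \<bar>f y - f z\<bar>"
  have pt: "ennreal \<bar>?q x * f z - ?p x * g z\<bar> \<le> (\<integral>\<^sup>+ y. ennreal (heat_kernel s (x - y)) * ?Q z y \<partial>lborel)" for x z
  proof -
    have "\<bar>?q x * f z - ?p x * g z\<bar> = \<bar>f z * (?q x - g z) - g z * (?p x - f z)\<bar>" by (simp add: algebra_simps)
    also have "\<dots> \<le> \<bar>f z * (?q x - g z)\<bar> + \<bar>g z * (?p x - f z)\<bar>" by (rule abs_triangle_ineq4)
    also have "\<dots> = f z * \<bar>?q x - g z\<bar> + g z * \<bar>?p x - f z\<bar>" using f0 g0 by (simp add: abs_mult)
    finally have "ennreal \<bar>?q x * f z - ?p x * g z\<bar> \<le> ennreal (f z) * ennreal \<bar>?q x - g z\<bar> + ennreal (g z) * ennreal \<bar>?p x - f z\<bar>"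
      using f0 g0 by (simp add: ennreal_mult[symmetric] ennreal_plus[symmetric] ennreal_leI del: ennreal_plus)
    also have "\<dots> \<le> ennreal (f z) * (\<integral>\<^sup>+ y. ennreal (heat_kernel s (x - y) * \<bar>g y - g z\<bar>) \<partial>lborel) + 
       ennreal (g z) * (\<integral>\<^sup>+ y. ennreal (heat_kernel s (x - y) * \<bar>f y - f z\<bar>) \<partial>lborel)"
      by (intro add_mono mult_left_mono heat_minus_const_le s f g) auto
    also have "\<dots> = (\<integral>\<^sup>+ y. ennreal (heat_kernel s (x - y)) * ?Q z y \<partial>lborel)"
      by (simp add: nn_integral_add[symmetric] nn_integral_cmult[symmetric] ennreal_mult distrib_left mult_ac)
    finally show ?thesis .
  qed
  have "ennreal \<bar>?q x * heat s (\<lambda>z. indicator B z * f z) x - ?p x * heat s (\<lambda>z. indicator B z * g z) x\<bar> \<le>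
    (\<integral>\<^sup>+ z. \<integral>\<^sup>+ y. ennreal (heat_kernel s (z - x) * heat_kernel s (x - y)) * (indicator B z * ?Q z y) \<partial>lborel \<partial>lborel)" for x
  proof -
    have int: "integrable lborel (\<lambda>z. ?q x * (heat_kernel s (x - z) * (indicator B z * f z)) - ?p x * (heat_kernel s (x - z) * (indicator B z * g z)))"
      by (intro Bochner_Integration.integrable_diff integrable_mult_right integrable_heat_real s Bf Bg)
    have "?q x * heat s (\<lambda>z. indicator B z * f z) x - ?p x * heat s (\<lambda>z. indicator B z * g z) x =
      (LINT z|lborel. ?q x * (heat_kernel s (x - z) * (indicator B z * f z)) - ?p x * (heat_kernel s (x - z) * (indicator B z * g z)))"
      unfolding heat_def[of s "\<lambda>z. indicator B z * _ z"] real_scaleR_def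
      using integrable_heat_real[OF s Bf] integrable_heat_real[OF s Bg] by simp
    then have "ennreal \<bar>?q x * heat s (\<lambda>z. indicator B z * f z) x - ?p x * heat s (\<lambda>z. indicator B z * g z) x\<bar> \<le>
      (\<integral>\<^sup>+ z. ennreal \<bar>?q x * (heat_kernel s (x - z) * (indicator B z * f z)) - ?p x * (heat_kernel s (x - z) * (indicator B z * g z))\<bar> \<partial>lborel)"
      using integral_norm_bound_ennreal[OF int] by simp
    also have "\<dots> = (\<integral>\<^sup>+ z. ennreal (heat_kernel s (z - x)) * indicator B z * ennreal \<bar>?q x * f z - ?p x * g z\<bar> \<partial>lborel)"
    proof (rule nn_integral_cong)
      fix z
      have "?q x * (heat_kernel s (x - z) * (indicator B z * f z)) - ?p x * (heat_kernel s (x - z) * (indicator B z * g z)) =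
        heat_kernel s (x - z) * indicator B z * (?q x * f z - ?p x * g z)" by (simp add: algebra_simps)
      then show "ennreal \<bar>?q x * (heat_kernel s (x - z) * (indicator B z * f z)) - ?p x * (heat_kernel s (x - z) * (indicator B z * g z))\<bar> =
        ennreal (heat_kernel s (z - x)) * indicator B z * ennreal \<bar>?q x * f z - ?p x * g z\<bar>"
        by (simp only:) (simp add: abs_mult ennreal_mult heat_kernel_minus_commute indicator_def)
    qed
    also have "\<dots> \<le> (\<integral>\<^sup>+ z. ennreal (heat_kernel s (z - x)) * indicator B z * (\<integral>\<^sup>+ y. ennreal (heat_kernel s (x - y)) * ?Q z y \<partial>lborel) \<partial>lborel)"
      by (intro nn_integral_mono mult_left_mono pt) auto
    also have "\<dots> = (\<integral>\<^sup>+ z. \<integral>\<^sup>+ y. ennreal (heat_kernel s (z - x) * heat_kernel s (x - y)) * (indicator B z * ?Q z y) \<partial>lborel \<partial>lborel)"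
      by (simp add: nn_integral_cmult[symmetric] ennreal_mult mult_ac)
    finally show ?thesis .
  qed
  then have "(\<integral>\<^sup>+ x. ennreal \<bar>?q x * heat s (\<lambda>z. indicator B z * f z) x - ?p x * heat s (\<lambda>z. indicator B z * g z) x\<bar> \<partial>lborel) \<le>
    (\<integral>\<^sup>+ x. \<integral>\<^sup>+ z. \<integral>\<^sup>+ y. ennreal (heat_kernel s (z - x) * heat_kernel s (x - y)) * (indicator B z * ?Q z y) \<partial>lborel \<partial>lborel \<partial>lborel)"
    by (intro nn_integral_mono)
  also have "\<dots> = (\<integral>\<^sup>+ z. \<integral>\<^sup>+ x. \<integral>\<^sup>+ y. ennreal (heat_kernel s (z - x) * heat_kernel s (x - y)) * (indicator B z * ?Q z y) \<partial>lborel \<partial>lborel \<partial>lborel)"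
    by (rule lborel_pair.Fubini') measurable
  also have "\<dots> = (\<integral>\<^sup>+ z. \<integral>\<^sup>+ y. \<integral>\<^sup>+ x. ennreal (heat_kernel s (z - x) * heat_kernel s (x - y)) * (indicator B z * ?Q z y) \<partial>lborel \<partial>lborel \<partial>lborel)"
    by (intro nn_integral_cong lborel_pair.Fubini') measurable
  also have "\<dots> = (\<integral>\<^sup>+ z. \<integral>\<^sup>+ y. ennreal (heat_kernel (2 * s) (z - y)) * (indicator B z * ?Q z y) \<partial>lborel \<partial>lborel)"
    by (subst nn_integral_multc) (measurable, simp only: heat_kernel_convolution[OF s s] mult_2)
  also have "\<dots> = (\<integral>\<^sup>+ z. indicator B z * (ennreal (f z) * (\<integral>\<^sup>+ y. ennreal (heat_kernel (2 * s) (z - y) * \<bar>g y - g z\<bar>) \<partial>lborel) +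
      ennreal (g z) * (\<integral>\<^sup>+ y. ennreal (heat_kernel (2 * s) (z - y) * \<bar>f y - f z\<bar>) \<partial>lborel)) \<partial>lborel)"
    by (simp add: nn_integral_add[symmetric] nn_integral_cmult[symmetric] ennreal_mult distrib_left mult_ac)
  finally show ?thesis .
qed

lemma commutator_eventually_le:
  fixes f g :: "'a::euclidean_space \<Rightarrow> real"
  assumes cf: "continuous_on UNIV f" and cg: "continuous_on UNIV g" and f: "nonneg_L2 f" and g: "nonneg_L2 g" and \<epsilon>: "0 < \<epsilon>"
  shows "\<forall>\<^sub>F s in at_right 0. (\<integral>\<^sup>+ x. ennreal \<bar>heat s g x * heat s (\<lambda>z. indicator (ball 0 a) z * f z) x - 
     heat s f x * heat s (\<lambda>z. indicator (ball 0 a) z * g z) x\<bar> \<partial>lborel) \<le> ennreal \<epsilon>"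
proof -
  note [measurable] = nonneg_L2D(1)[OF f] nonneg_L2D(1)[OF g]
  have [measurable]: "ball (0::'a) a \<in> sets borel" by simp
  have f0: "0 \<le> f z" and g0: "0 \<le> g z" for z using nonneg_L2D(2)[OF f] nonneg_L2D(2)[OF g] by auto
  \<comment> \<open>Finite because \<open>f z \<le> 1 + (f z)\<^sup>2\<close> on a set of finite
    measure. With increments of size at most \<open>e\<close> on the ball the commutator is at most
    \<open>e * L\<close>.\<close>
  define L where "L = (LINT z|lborel. indicator (ball 0 a) z * (f z + g z))"
  have Lint: "integrable lborel (\<lambda>z. indicator (ball 0 a) z * (f z + g z))"
  proof (rule Bochner_Integration.integrable_bound)
    have "emeasure lborel (ball (0::'a) a) < \<infinity>" by (rule emeasure_bounded_finite) simp
    then show "integrable lborel (\<lambda>z::'a. 2 * indicator (ball 0 a) z + (f z)\<^sup>2 + (g z)\<^sup>2)"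
      using nonneg_L2D(3)[OF f] nonneg_L2D(3)[OF g] by (simp add: integrable_real_indicator)
    have "f z + g z \<le> 2 + (f z)\<^sup>2 + (g z)\<^sup>2" for z
      using sum_squares_bound[of "f z" 1] sum_squares_bound[of "g z" 1] f0[of z] g0[of z] by (simp add: power2_eq_square)
    then show "AE z in lborel. norm (indicator (ball 0 a) z * (f z + g z)) \<le> norm (2 * indicator (ball 0 a) z + (f z)\<^sup>2 + (g z)\<^sup>2)"
      using f0 g0 by (auto simp: indicator_def)
  qed measurable
  have L0: "0 \<le> L" unfolding L_def using f0 g0 by (intro integral_nonneg_AE) auto
  define e where "e = \<epsilon> / (L + 1)"
  have e: "0 < e" "e * L \<le> \<epsilon>" using \<epsilon> L0 by (auto simp: e_def field_simps)
  have "\<forall>\<^sub>F s in at_right 0. (\<forall>z\<in>cball 0 a. (\<integral>\<^sup>+ y. ennreal (heat_kernel s (z - y) * \<bar>f y - f z\<bar>) \<partial>lborel) \<le> ennreal e) \<and>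
     (\<forall>z\<in>cball 0 a. (\<integral>\<^sup>+ y. ennreal (heat_kernel s (z - y) * \<bar>g y - g z\<bar>) \<partial>lborel) \<le> ennreal e)"
    by (intro eventually_conj heat_kernel_approx_uniform cf cg f g e)
  moreover have "filterlim (\<lambda>s::real. 2 * s) (at_right 0) (at_right 0)" by real_asymp
  ultimately have "\<forall>\<^sub>F s in at_right 0. (\<forall>z\<in>cball 0 a. (\<integral>\<^sup>+ y. ennreal (heat_kernel (2 * s) (z - y) * \<bar>f y - f z\<bar>) \<partial>lborel) \<le> ennreal e) \<and>
     (\<forall>z\<in>cball 0 a. (\<integral>\<^sup>+ y. ennreal (heat_kernel (2 * s) (z - y) * \<bar>g y - g z\<bar>) \<partial>lborel) \<le> ennreal e)"
    by (rule eventually_compose_filterlim)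
  moreover have "\<forall>\<^sub>F s in at_right (0::real). 0 < s" by (simp add: eventually_at_right_less)
  ultimately show ?thesis
  proof eventually_elim
    case (elim s)
    have "(\<integral>\<^sup>+ x. ennreal \<bar>heat s g x * heat s (\<lambda>z. indicator (ball 0 a) z * f z) x - 
     heat s f x * heat s (\<lambda>z. indicator (ball 0 a) z * g z) x\<bar> \<partial>lborel) \<le> 
     (\<integral>\<^sup>+ z. indicator (ball 0 a) z * (ennreal (f z) * (\<integral>\<^sup>+ y. ennreal (heat_kernel (2 * s) (z - y) * \<bar>g y - g z\<bar>) \<partial>lborel) +
      ennreal (g z) * (\<integral>\<^sup>+ y. ennreal (heat_kernel (2 * s) (z - y) * \<bar>f y - f z\<bar>) \<partial>lborel)) \<partial>lborel)"
      using elim by (intro commutator_le f g) auto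
    also have "\<dots> \<le> (\<integral>\<^sup>+ z. ennreal e * ennreal (indicator (ball 0 a) z * (f z + g z)) \<partial>lborel)"
    proof (rule nn_integral_mono)
      fix z :: 'a
      show "indicator (ball 0 a) z * (ennreal (f z) * (\<integral>\<^sup>+ y. ennreal (heat_kernel (2 * s) (z - y) * \<bar>g y - g z\<bar>) \<partial>lborel) +
        ennreal (g z) * (\<integral>\<^sup>+ y. ennreal (heat_kernel (2 * s) (z - y) * \<bar>f y - f z\<bar>) \<partial>lborel)) \<le>
        ennreal e * ennreal (indicator (ball 0 a) z * (f z + g z))"
      proof (cases "z \<in> ball 0 a")
        case True
        then have "ennreal (f z) * (\<integral>\<^sup>+ y. ennreal (heat_kernel (2 * s) (z - y) * \<bar>g y - g z\<bar>) \<partial>lborel) +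
          ennreal (g z) * (\<integral>\<^sup>+ y. ennreal (heat_kernel (2 * s) (z - y) * \<bar>f y - f z\<bar>) \<partial>lborel) \<le> 
          ennreal (f z) * ennreal e + ennreal (g z) * ennreal e"
          using elim by (intro add_mono mult_left_mono) auto
        then show ?thesis using True f0 g0 e by (simp add: distrib_left mult.commute)
      qed simp
    qed
    also have "\<dots> = ennreal e * ennreal L"
      unfolding L_def using f0 g0 Lint by (subst nn_integral_cmult) (auto intro!: arg_cong2[where f = times] nn_integral_eq_integral)
    also have "\<dots> \<le> ennreal \<epsilon>" using e L0 by (simp add: ennreal_mult[symmetric] ennreal_leI)
    finally show ?case .
  qed
qed

section \<open>The symmetrized energy\<close>

text \<open>
  Where \<open>p\<close> and \<open>q\<close> both vanish, the quotient is \<open>0\<close>, so that the symmetrization identity needs only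
  nonnegativity.
\<close>

definition energy_density :: "('a \<Rightarrow> real) \<Rightarrow> ('a \<Rightarrow> real) \<Rightarrow> 'a \<Rightarrow> 'a \<Rightarrow> real" where
  "energy_density p q x y = (p x * q y - q x * p y)\<^sup>2 / ((p x + q x) * (p y + q y))"

lemma energy_density_nonneg: "(\<And>x. 0 \<le> p x) \<Longrightarrow> (\<And>x. 0 \<le> q x) \<Longrightarrow> 0 \<le> energy_density p q x y"
  by (simp add: energy_density_def)

text \<open>The first factor on the right is the increment of the quotient
  \<open>p / (p + q)\<close>; this is the identity that turns the symmetrized form into a
  square.\<close>

lemma energy_density_eq:
  assumes "\<And>x. 0 \<le> p x" "\<And>x. 0 \<le> q x"
  shows "energy_density p q x y = (p x / (p x + q x) - p y / (p y + q y)) * (p x * q y - q x * p y)"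
proof (cases "p x + q x = 0 \<or> p y + q y = 0")
  case True
  then have "(p x = 0 \<and> q x = 0) \<or> (p y = 0 \<and> q y = 0)"
    using assms[of x] assms[of y] by (auto simp: add_nonneg_eq_0_iff)
  then show ?thesis by (auto simp: energy_density_def)
next
  case False
  then have "p x / (p x + q x) - p y / (p y + q y) = (p x * q y - q x * p y) / ((p x + q x) * (p y + q y))"
    by (simp add: diff_frac_eq algebra_simps)
  then show ?thesis by (simp add: energy_density_def power2_eq_square)
qed

lemma measurable_energy_density [measurable (raw)]:
  assumes [measurable]: "p \<in> borel_measurable borel" "q \<in> borel_measurable borel" "f \<in> borel_measurable M" "g \<in> borel_measurable M"
  shows "(\<lambda>x. energy_density p q (f x) (g x)) \<in> borel_measurable M"
  unfolding energy_density_def by measurable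

text \<open>\<open>Z\<close> is the integrand on the right written over pairs. The kernel is
  symmetric and \<open>p x * q y - q x * p y\<close> antisymmetric, so \<open>Z x y + Z y x\<close>
  is the energy integrand; both terms have the same integral, whence the factor 2. The second claim
  is stated separately because \<open>ennreal\<close> sends negative reals to 0, so the first does
  not give the sign.\<close>

lemma nn_integral_energy_density:
  fixes p q :: "'a::euclidean_space \<Rightarrow> real"
  assumes t: "0 < t" and p: "nonneg_L2 p" and q: "nonneg_L2 q"
  shows "(\<integral>\<^sup>+ x. \<integral>\<^sup>+ y. ennreal (heat_kernel t (x - y) * energy_density p q x y) \<partial>lborel \<partial>lborel) =
    ennreal (2 * (LINT x|lborel. p x / (p x + q x) * (p x * heat t q x - q x * heat t p x)))" (is ?eq)
    and "0 \<le> (LINT x|lborel. p x / (p x + q x) * (p x * heat t q x - q x * heat t p x))" (is ?nonneg)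
proof -
  note [measurable] = nonneg_L2D(1)[OF p] nonneg_L2D(1)[OF q]
  have p0: "0 \<le> p z" and q0: "0 \<le> q z" for z using nonneg_L2D(2)[OF p] nonneg_L2D(2)[OF q] by auto
  define h where "h x = p x / (p x + q x)" for x
  have [measurable]: "h \<in> borel_measurable borel" unfolding h_def by measurable
  have h: "0 \<le> h x" "h x \<le> 1" for x using p0[of x] q0[of x] by (auto simp: h_def divide_le_eq_1)
  define Z where "Z x y = h x * (heat_kernel t (x - y) * (p x * q y - q x * p y))" for x y
  have int: "integrable (lborel \<Otimes>\<^sub>M lborel) (\<lambda>(x, y). u x * heat_kernel t (x - y) * w y)" if u: "nonneg_L2 u" and w: "nonneg_L2 w" for u w :: "'a \<Rightarrow> real"
  proof -
    note [measurable] = nonneg_L2D(1)[OF u] nonneg_L2D(1)[OF w]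
    have uw0: "0 \<le> u z" "0 \<le> w z" for z using nonneg_L2D(2)[OF u] nonneg_L2D(2)[OF w] by auto
    have "(\<integral>\<^sup>+ x. \<integral>\<^sup>+ y. ennreal (u x * heat_kernel t (x - y) * w y) \<partial>lborel \<partial>lborel) \<le>
      (\<integral>\<^sup>+ x. ennreal (heat_kernel t (x::'a)) \<partial>lborel) * ((\<integral>\<^sup>+ x. ennreal ((u x)\<^sup>2) \<partial>lborel) + (\<integral>\<^sup>+ x. ennreal ((w x)\<^sup>2) \<partial>lborel))"
      by (rule nn_integral_convolution_le) measurable
    also have "\<dots> < \<infinity>"
      using nonneg_L2D(4)[OF u] nonneg_L2D(4)[OF w] nn_integral_heat_kernel(2)[OF t, of "0::'a"] by simp
    finally have "(\<integral>\<^sup>+ z. ennreal (case z of (x, y) \<Rightarrow> u x * heat_kernel t (x - y) * w y) \<partial>(lborel \<Otimes>\<^sub>M lborel)) < \<infinity>"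
      by (subst lborel.nn_integral_fst[symmetric]) auto
    then show ?thesis using uw0 by (intro integrableI_nonneg) auto
  qed
  have Zint: "integrable (lborel \<Otimes>\<^sub>M lborel) (\<lambda>(x, y). Z x y)"
  proof (rule Bochner_Integration.integrable_bound)
    show "integrable (lborel \<Otimes>\<^sub>M lborel) (\<lambda>z. (case z of (x, y) \<Rightarrow> p x * heat_kernel t (x - y) * q y) + (case z of (x, y) \<Rightarrow> q x * heat_kernel t (x - y) * p y))"
      by (intro Bochner_Integration.integrable_add int p q)
    show "(\<lambda>(x, y). Z x y) \<in> borel_measurable (lborel \<Otimes>\<^sub>M lborel)" unfolding Z_def by measurable
    have "\<bar>Z x y\<bar> \<le> p x * heat_kernel t (x - y) * q y + q x * heat_kernel t (x - y) * p y" for x y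
    proof -
      have "\<bar>Z x y\<bar> = h x * (heat_kernel t (x - y) * \<bar>p x * q y - q x * p y\<bar>)" using h by (simp add: Z_def abs_mult)
      also have "\<dots> \<le> 1 * (heat_kernel t (x - y) * (p x * q y + q x * p y))"
        using h[of x] p0[of x] q0[of x] p0[of y] q0[of y]
        by (intro mult_mono mult_left_mono) (auto simp: abs_le_iff add_increasing add_increasing2)
      finally show ?thesis by (simp add: algebra_simps)
    qed
    then show "AE z in lborel \<Otimes>\<^sub>M lborel. norm (case z of (x, y) \<Rightarrow> Z x y) \<le> 
      norm ((case z of (x, y) \<Rightarrow> p x * heat_kernel t (x - y) * q y) + (case z of (x, y) \<Rightarrow> q x * heat_kernel t (x - y) * p y))"
      by (auto intro!: AE_I2 intro: order_trans[OF _ abs_ge_self])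
  qed
  have Zint': "integrable (lborel \<Otimes>\<^sub>M lborel) (\<lambda>(x, y). Z y x)"
    using lborel_pair.integrable_product_swap[OF Zint] by (simp add: split_beta')
  have Zswap: "(LINT z|(lborel \<Otimes>\<^sub>M lborel). (case z of (x, y) \<Rightarrow> Z y x)) = (LINT z|(lborel \<Otimes>\<^sub>M lborel). (case z of (x, y) \<Rightarrow> Z x y))"
    using lborel_pair.integral_product_swap[OF borel_measurable_integrable[OF Zint]] by (simp add: split_beta')
  have inner: "(LINT y|lborel. Z x y) = h x * (p x * heat t q x - q x * heat t p x)" for x
  proof -
    have "Z x y = h x * (p x * (heat_kernel t (x - y) * q y) - q x * (heat_kernel t (x - y) * p y))" for y
      by (simp add: Z_def algebra_simps)
    then have "(LINT y|lborel. Z x y) = h x * (LINT y|lborel. p x * (heat_kernel t (x - y) * q y) - q x * (heat_kernel t (x - y) * p y))"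
      by (simp only: integral_mult_right_zero)
    then show ?thesis using integrable_heat_real[OF t p, of x] integrable_heat_real[OF t q, of x] by (simp add: heat_def)
  qed
  have sum: "Z x y + Z y x = heat_kernel t (x - y) * energy_density p q x y" for x y
    unfolding energy_density_eq[OF p0 q0] h_def[symmetric] Z_def heat_kernel_minus_commute[of t y x] by (simp add: algebra_simps)
  have "(\<integral>\<^sup>+ x. \<integral>\<^sup>+ y. ennreal (heat_kernel t (x - y) * energy_density p q x y) \<partial>lborel \<partial>lborel) =
    (\<integral>\<^sup>+ z. ennreal (case z of (x, y) \<Rightarrow> heat_kernel t (x - y) * energy_density p q x y) \<partial>(lborel \<Otimes>\<^sub>M lborel))"
    by (subst lborel.nn_integral_fst[symmetric]) auto
  also have "\<dots> = (\<integral>\<^sup>+ z. ennreal ((case z of (x, y) \<Rightarrow> Z x y) + (case z of (x, y) \<Rightarrow> Z y x)) \<partial>(lborel \<Otimes>\<^sub>M lborel))"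
    by (intro nn_integral_cong) (auto simp: sum)
  also have "\<dots> = ennreal (LINT z|(lborel \<Otimes>\<^sub>M lborel). (case z of (x, y) \<Rightarrow> Z x y) + (case z of (x, y) \<Rightarrow> Z y x))"
    by (intro nn_integral_eq_integral Bochner_Integration.integrable_add Zint Zint')
       (auto intro!: AE_I2 mult_nonneg_nonneg energy_density_nonneg p0 q0 simp: sum)
  also have eq2: "(LINT z|(lborel \<Otimes>\<^sub>M lborel). (case z of (x, y) \<Rightarrow> Z x y) + (case z of (x, y) \<Rightarrow> Z y x)) = 
    2 * (LINT z|(lborel \<Otimes>\<^sub>M lborel). (case z of (x, y) \<Rightarrow> Z x y))"
    using Zint Zint' Zswap by simp
  also have eq3: "(LINT z|(lborel \<Otimes>\<^sub>M lborel). (case z of (x, y) \<Rightarrow> Z x y)) = (LINT x|lborel. LINT y|lborel. Z x y)"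
    using lborel_pair.integral_fst'[OF Zint] by simp
  finally show ?eq by (simp add: inner h_def)
  have "0 \<le> (LINT z|(lborel \<Otimes>\<^sub>M lborel). (case z of (x, y) \<Rightarrow> Z x y) + (case z of (x, y) \<Rightarrow> Z y x))"
    by (intro integral_nonneg_AE) (auto intro!: AE_I2 mult_nonneg_nonneg energy_density_nonneg p0 q0 simp: sum)
  then show ?nonneg unfolding eq2 eq3 by (simp add: inner h_def)
qed

text \<open>
  Together with the integrability of \<open>\<nu>(t) (1 - exp (- z t))\<close> this makes the interchange of the \<open>t\<close> and
  \<open>x\<close> integrals absolutely convergent.
\<close>

lemma nn_integral_heat_time_diff:
  fixes f u :: "'a::euclidean_space \<Rightarrow> real"
  assumes s: "0 < s" and t: "0 < t" and f: "nonneg_L2 f" and u: "nonneg_L2 u"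
  shows "(\<integral>\<^sup>+ x. ennreal (u x * \<bar>heat (s + t) f x - heat s f x\<bar>) \<partial>lborel) \<le>
    ennreal (2 * (1 - exp (- (real DIM('a) / (2 * s)) * t))) * ((\<integral>\<^sup>+ x. ennreal ((u x)\<^sup>2) \<partial>lborel) + (\<integral>\<^sup>+ x. ennreal ((f x)\<^sup>2) \<partial>lborel))"
proof -
  note [measurable] = nonneg_L2D(1)[OF f] nonneg_L2D(1)[OF u]
  have f0: "0 \<le> f z" and u0: "0 \<le> u z" for z using nonneg_L2D(2)[OF f] nonneg_L2D(2)[OF u] by auto
  have st: "0 < s + t" using s t by simp
  let ?K = "\<lambda>x::'a. \<bar>heat_kernel (s + t) x - heat_kernel s x\<bar>"
  have "(\<integral>\<^sup>+ x. ennreal (u x * \<bar>heat (s + t) f x - heat s f x\<bar>) \<partial>lborel) \<le> (\<integral>\<^sup>+ x. \<integral>\<^sup>+ y. ennreal (u x * ?K (x - y) * f y) \<partial>lborel \<partial>lborel)"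
  proof (rule nn_integral_mono)
    fix x
    have int: "integrable lborel (\<lambda>y. heat_kernel (s + t) (x - y) * f y - heat_kernel s (x - y) * f y)"
      by (intro Bochner_Integration.integrable_diff integrable_heat_real s st f)
    have "heat (s + t) f x - heat s f x = (LINT y|lborel. heat_kernel (s + t) (x - y) * f y - heat_kernel s (x - y) * f y)"
      using integrable_heat_real[OF s f, of x] integrable_heat_real[OF st f, of x] by (simp add: heat_def)
    then have "ennreal \<bar>heat (s + t) f x - heat s f x\<bar> \<le> (\<integral>\<^sup>+ y. ennreal \<bar>heat_kernel (s + t) (x - y) * f y - heat_kernel s (x - y) * f y\<bar> \<partial>lborel)"
      using integral_norm_bound_ennreal[OF int] by simp
    also have "\<dots> = (\<integral>\<^sup>+ y. ennreal (?K (x - y) * f y) \<partial>lborel)"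
      using f0 by (simp add: abs_mult flip: left_diff_distrib)
    finally have "ennreal (u x) * ennreal \<bar>heat (s + t) f x - heat s f x\<bar> \<le> ennreal (u x) * \<dots>"
      by (rule mult_left_mono) simp
    then show "ennreal (u x * \<bar>heat (s + t) f x - heat s f x\<bar>) \<le> (\<integral>\<^sup>+ y. ennreal (u x * ?K (x - y) * f y) \<partial>lborel)"
      using u0 f0 by (simp add: ennreal_mult nn_integral_cmult[symmetric] mult.assoc)
  qed
  also have "\<dots> \<le> (\<integral>\<^sup>+ x. ennreal (?K x) \<partial>lborel) * ((\<integral>\<^sup>+ x. ennreal ((u x)\<^sup>2) \<partial>lborel) + (\<integral>\<^sup>+ x. ennreal ((f x)\<^sup>2) \<partial>lborel))"
    by (rule nn_integral_convolution_le) auto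
  also have "\<dots> \<le> ennreal (2 * (1 - exp (- (real DIM('a) / (2 * s)) * t))) * ((\<integral>\<^sup>+ x. ennreal ((u x)\<^sup>2) \<partial>lborel) + (\<integral>\<^sup>+ x. ennreal ((f x)\<^sup>2) \<partial>lborel))"
    by (intro mult_right_mono heat_kernel_time_diff s t) auto
  finally show ?thesis .
qed

text \<open>
  The eigenvalue equation of \<open>L - v 1\<^sub>B\<close> for \<open>f\<close> and \<open>l\<close>, convolved with the heat kernel at time \<open>s\<close>
  and multiplied by the normalization \<open>C\<close> of the Levy density.
\<close>

definition mollified_eigenequation :: "real \<Rightarrow> real \<Rightarrow> real \<Rightarrow> real \<Rightarrow> ('a::euclidean_space) set \<Rightarrow> real \<Rightarrow> real \<Rightarrow> ('a \<Rightarrow> real) \<Rightarrow> bool" where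
  "mollified_eigenequation m \<alpha> C l B v s f \<longleftrightarrow> (\<forall>x. 
     integrable lborel (\<lambda>t. levy_density m \<alpha> t * (heat s f x - heat (s + t) f x)) \<and>
     (LINT t|lborel. levy_density m \<alpha> t * (heat s f x - heat (s + t) f x)) =
       C * (l * heat s f x + v * heat s (\<lambda>z. indicator B z * f z) x))"

text \<open>The double integral of \<open>levy_density m \<alpha> t * E t x\<close> is computed in
  two orders. Integrating over \<open>x\<close> first gives half the energy at time
  \<open>t\<close>, since \<open>heat t (heat s f) = heat (s + t) f\<close>. Integrating over
  \<open>t\<close> first, the eigenequations leave \<open>C * v * (h x * G x)\<close>, and
  \<open>0 \<le> h \<le> 1\<close>.\<close>

lemma energy_le_commutator:
  fixes f g :: "'a::euclidean_space \<Rightarrow> real"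
  assumes fin: "\<And>z. 0 \<le> z \<Longrightarrow> (\<integral>\<^sup>+ t. ennreal (levy_density m \<alpha> t * (1 - exp (- z * t))) \<partial>lborel) < \<infinity>"
    and C: "0 \<le> C" and v: "0 \<le> v" and s: "0 < s" and f: "nonneg_L2 f" and g: "nonneg_L2 g" and [measurable]: "B \<in> sets borel"
    and ef: "mollified_eigenequation m \<alpha> C l B v s f" and eg: "mollified_eigenequation m \<alpha> C l B v s g"
  shows "(\<integral>\<^sup>+ t. \<integral>\<^sup>+ x. \<integral>\<^sup>+ y. ennreal (levy_density m \<alpha> t * (heat_kernel t (x - y) * energy_density (heat s f) (heat s g) x y)) \<partial>lborel \<partial>lborel \<partial>lborel) \<le>
    ennreal (2 * C * v) * (\<integral>\<^sup>+ x. ennreal \<bar>heat s g x * heat s (\<lambda>z. indicator B z * f z) x - heat s f x * heat s (\<lambda>z. indicator B z * g z) x\<bar> \<partial>lborel)"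
proof -
  note [measurable] = nonneg_L2D(1)[OF f] nonneg_L2D(1)[OF g] measurable_heat_pair
  let ?\<nu> = "levy_density m \<alpha>"
  let ?p = "heat s f" and ?q = "heat s g"
  have p: "nonneg_L2 ?p" and q: "nonneg_L2 ?q" using nonneg_L2_heat s f g by auto
  have p0: "0 \<le> ?p z" and q0: "0 \<le> ?q z" for z using nonneg_L2D(2)[OF p] nonneg_L2D(2)[OF q] by auto
  define h where "h x = ?p x / (?p x + ?q x)" for x
  have [measurable]: "h \<in> borel_measurable borel" unfolding h_def by measurable
  have h: "0 \<le> h x" "h x \<le> 1" for x using p0[of x] q0[of x] by (auto simp: h_def divide_le_eq_1)
  define G where "G x = ?q x * heat s (\<lambda>z. indicator B z * f z) x - ?p x * heat s (\<lambda>z. indicator B z * g z) x" for x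
  define E where "E t x = h x * (?p x * heat (s + t) g x - ?q x * heat (s + t) f x)" for t x
  have Em [measurable]: "(\<lambda>(t, x). E t x) \<in> borel_measurable (lborel \<Otimes>\<^sub>M lborel)" unfolding E_def by measurable
  have Wm: "(\<lambda>(t, x). ?\<nu> t * E t x) \<in> borel_measurable (lborel \<Otimes>\<^sub>M lborel)" by measurable
  let ?z = "real DIM('a) / (2 * s)"
  let ?N = "((\<integral>\<^sup>+ x. ennreal ((?p x)\<^sup>2) \<partial>lborel) + (\<integral>\<^sup>+ x. ennreal ((g x)\<^sup>2) \<partial>lborel)) + ((\<integral>\<^sup>+ x. ennreal ((?q x)\<^sup>2) \<partial>lborel) + (\<integral>\<^sup>+ x. ennreal ((f x)\<^sup>2) \<partial>lborel))"
  \<comment> \<open>Inserting \<open>?p x * ?q x\<close> expresses \<open>E\<close> through the time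
    increments of \<open>heat s g\<close> and \<open>heat s f\<close>. Their estimate contributes
    \<open>1 - exp (- ?z * t)\<close>, whose integral against the density is finite by
    \<open>fin\<close>.\<close>
  have bound: "(\<integral>\<^sup>+ x. ennreal \<bar>?\<nu> t * E t x\<bar> \<partial>lborel) \<le> ennreal (?\<nu> t * (1 - exp (- ?z * t))) * (2 * ?N)" for t
  proof (cases "0 < t")
    case True
    have "(\<integral>\<^sup>+ x. ennreal \<bar>E t x\<bar> \<partial>lborel) \<le> (\<integral>\<^sup>+ x. ennreal (?p x * \<bar>heat (s + t) g x - ?q x\<bar>) + ennreal (?q x * \<bar>heat (s + t) f x - ?p x\<bar>) \<partial>lborel)"
    proof (rule nn_integral_mono)
      fix x
      have "\<bar>E t x\<bar> = h x * \<bar>?p x * (heat (s + t) g x - ?q x) - ?q x * (heat (s + t) f x - ?p x)\<bar>"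
      proof -
        have "E t x = h x * (?p x * (heat (s + t) g x - ?q x) - ?q x * (heat (s + t) f x - ?p x))"
          by (simp add: E_def algebra_simps)
        then show ?thesis using h[of x] by (simp only: abs_mult abs_of_nonneg)
      qed
      also have "\<dots> \<le> 1 * (\<bar>?p x * (heat (s + t) g x - ?q x)\<bar> + \<bar>?q x * (heat (s + t) f x - ?p x)\<bar>)"
        using h by (intro mult_mono abs_triangle_ineq4) auto
      also have "\<dots> = ?p x * \<bar>heat (s + t) g x - ?q x\<bar> + ?q x * \<bar>heat (s + t) f x - ?p x\<bar>"
        using p0 q0 by (simp add: abs_mult)
      finally show "ennreal \<bar>E t x\<bar> \<le> ennreal (?p x * \<bar>heat (s + t) g x - ?q x\<bar>) + ennreal (?q x * \<bar>heat (s + t) f x - ?p x\<bar>)"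
        using p0 q0 by (simp add: ennreal_plus[symmetric] ennreal_leI del: ennreal_plus)
    qed
    also have "\<dots> = (\<integral>\<^sup>+ x. ennreal (?p x * \<bar>heat (s + t) g x - ?q x\<bar>) \<partial>lborel) + (\<integral>\<^sup>+ x. ennreal (?q x * \<bar>heat (s + t) f x - ?p x\<bar>) \<partial>lborel)"
      by (rule nn_integral_add) measurable
    also have "\<dots> \<le> ennreal (2 * (1 - exp (- ?z * t))) * ?N"
      unfolding distrib_left[of _ "_ + _" "_ + _"] by (intro add_mono nn_integral_heat_time_diff s True f g p q)
    finally have "ennreal (?\<nu> t) * (\<integral>\<^sup>+ x. ennreal \<bar>E t x\<bar> \<partial>lborel) \<le> ennreal (?\<nu> t) * (ennreal (2 * (1 - exp (- ?z * t))) * ?N)"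
      by (rule mult_left_mono) simp
    moreover have "ennreal (?\<nu> t) * (\<integral>\<^sup>+ x. ennreal \<bar>E t x\<bar> \<partial>lborel) = (\<integral>\<^sup>+ x. ennreal \<bar>?\<nu> t * E t x\<bar> \<partial>lborel)"
      by (subst nn_integral_cmult[symmetric]) (auto simp: abs_mult ennreal_mult)
    moreover have "ennreal (2 * (1 - exp (- ?z * t))) = 2 * ennreal (1 - exp (- ?z * t))"
      using s True by (subst ennreal_mult) auto
    moreover have "ennreal (?\<nu> t * (1 - exp (- ?z * t))) = ennreal (?\<nu> t) * ennreal (1 - exp (- ?z * t))"
      using s True by (subst ennreal_mult) auto
    ultimately show ?thesis by (simp only: mult_ac)
  qed (simp add: levy_density_def)
  have Wint: "integrable (lborel \<Otimes>\<^sub>M lborel) (\<lambda>(t, x). ?\<nu> t * E t x)"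
  proof (rule integrableI_bounded[OF Wm])
    have "(\<integral>\<^sup>+ w. ennreal (norm (case w of (t, x) \<Rightarrow> ?\<nu> t * E t x)) \<partial>(lborel \<Otimes>\<^sub>M lborel)) = (\<integral>\<^sup>+ t. \<integral>\<^sup>+ x. ennreal \<bar>?\<nu> t * E t x\<bar> \<partial>lborel \<partial>lborel)"
      by (subst lborel.nn_integral_fst[symmetric]) auto
    also have "\<dots> \<le> (\<integral>\<^sup>+ t. ennreal (?\<nu> t * (1 - exp (- ?z * t))) * (2 * ?N) \<partial>lborel)"
      by (intro nn_integral_mono bound)
    also have "\<dots> = (\<integral>\<^sup>+ t. ennreal (?\<nu> t * (1 - exp (- ?z * t))) \<partial>lborel) * (2 * ?N)"
      by (rule nn_integral_multc) measurable
    also have "\<dots> < \<infinity>"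
      using fin[of ?z] s nonneg_L2D(4)[OF f] nonneg_L2D(4)[OF g] nonneg_L2D(4)[OF p] nonneg_L2D(4)[OF q]
      by (auto simp: ennreal_mult_less_top)
    finally show "(\<integral>\<^sup>+ w. ennreal (norm (case w of (t, x) \<Rightarrow> ?\<nu> t * E t x)) \<partial>(lborel \<Otimes>\<^sub>M lborel)) < \<infinity>" .
  qed
  have Wt: "(LINT t|lborel. ?\<nu> t * E t x) = C * v * (h x * G x)" for x
  proof -
    from ef eg have i: "integrable lborel (\<lambda>t. ?\<nu> t * (?p x - heat (s + t) f x))" "integrable lborel (\<lambda>t. ?\<nu> t * (?q x - heat (s + t) g x))"
      and e: "(LINT t|lborel. ?\<nu> t * (?p x - heat (s + t) f x)) = C * (l * ?p x + v * heat s (\<lambda>z. indicator B z * f z) x)"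
      "(LINT t|lborel. ?\<nu> t * (?q x - heat (s + t) g x)) = C * (l * ?q x + v * heat s (\<lambda>z. indicator B z * g z) x)"
      unfolding mollified_eigenequation_def by auto
    \<comment> \<open>The two products of \<open>?p x\<close> and \<open>?q x\<close> cancel here,
      and so do the terms with \<open>l\<close> once the equations are inserted.\<close>
    have "(LINT t|lborel. ?\<nu> t * E t x) = (LINT t|lborel. (h x * ?q x) * (?\<nu> t * (?p x - heat (s + t) f x)) - (h x * ?p x) * (?\<nu> t * (?q x - heat (s + t) g x)))"
      by (intro Bochner_Integration.integral_cong) (auto simp: E_def algebra_simps)
    also have "\<dots> = (h x * ?q x) * (LINT t|lborel. ?\<nu> t * (?p x - heat (s + t) f x)) - (h x * ?p x) * (LINT t|lborel. ?\<nu> t * (?q x - heat (s + t) g x))"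
      using i by (simp only: Bochner_Integration.integral_diff integrable_mult_right integral_mult_right_zero)
    also have "\<dots> = C * v * (h x * G x)"
      unfolding e G_def by (simp add: algebra_simps)
    finally show ?thesis .
  qed
  have "(\<integral>\<^sup>+ t. \<integral>\<^sup>+ x. \<integral>\<^sup>+ y. ennreal (?\<nu> t * (heat_kernel t (x - y) * energy_density ?p ?q x y)) \<partial>lborel \<partial>lborel \<partial>lborel) =
    (\<integral>\<^sup>+ t. ennreal (2 * (LINT x|lborel. ?\<nu> t * E t x)) \<partial>lborel)"
  proof (rule nn_integral_cong)
    fix t :: real
    show "(\<integral>\<^sup>+ x. \<integral>\<^sup>+ y. ennreal (?\<nu> t * (heat_kernel t (x - y) * energy_density ?p ?q x y)) \<partial>lborel \<partial>lborel) = ennreal (2 * (LINT x|lborel. ?\<nu> t * E t x))"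
    proof (cases "0 < t")
      case True
      have "(\<integral>\<^sup>+ x. \<integral>\<^sup>+ y. ennreal (?\<nu> t * (heat_kernel t (x - y) * energy_density ?p ?q x y)) \<partial>lborel \<partial>lborel) =
        ennreal (?\<nu> t) * (\<integral>\<^sup>+ x. \<integral>\<^sup>+ y. ennreal (heat_kernel t (x - y) * energy_density ?p ?q x y) \<partial>lborel \<partial>lborel)"
        by (simp add: ennreal_mult' nn_integral_cmult)
      also have "\<dots> = ennreal (?\<nu> t) * ennreal (2 * (LINT x|lborel. E t x))"
        unfolding nn_integral_energy_density(1)[OF True p q] E_def h_def heat_heat[OF s True f] heat_heat[OF s True g] ..
      also have "\<dots> = ennreal (2 * (LINT x|lborel. ?\<nu> t * E t x))"
        by (simp add: ennreal_mult'[symmetric] mult_ac)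
      finally show ?thesis .
    qed (simp add: levy_density_def)
  qed
  also have "\<dots> = ennreal (LINT t|lborel. 2 * (LINT x|lborel. ?\<nu> t * E t x))"
  proof (rule nn_integral_eq_integral)
    show "integrable lborel (\<lambda>t. 2 * (LINT x|lborel. ?\<nu> t * E t x))"
      using lborel_pair.integrable_fst'[OF Wint] by simp
    have "0 \<le> (LINT x|lborel. E t x)" if "0 < t" for t
    proof -
      have "(LINT x|lborel. E t x) = (LINT x|lborel. ?p x / (?p x + ?q x) * (?p x * heat t ?q x - ?q x * heat t ?p x))"
        unfolding E_def h_def heat_heat[OF s that f] heat_heat[OF s that g] ..
      then show ?thesis using nn_integral_energy_density(2)[OF that p q] by simp
    qed
    then have "0 \<le> 2 * (LINT x|lborel. ?\<nu> t * E t x)" for t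
      by (cases "0 < t") (auto simp: levy_density_def)
    then show "AE t in lborel. 0 \<le> 2 * (LINT x|lborel. ?\<nu> t * E t x)" by simp
  qed
  also have "(LINT t|lborel. 2 * (LINT x|lborel. ?\<nu> t * E t x)) = 2 * (LINT x|lborel. C * v * (h x * G x))"
    using lborel_pair.Fubini_integral[OF Wint] by (simp add: Wt)
  also have "ennreal (2 * (LINT x|lborel. C * v * (h x * G x))) \<le> ennreal (2 * C * v) * (\<integral>\<^sup>+ x. ennreal \<bar>G x\<bar> \<partial>lborel)"
  proof -
    have "ennreal (LINT x|lborel. h x * G x) \<le> (\<integral>\<^sup>+ x. ennreal \<bar>G x\<bar> \<partial>lborel)"
    \<comment> \<open>Without integrability the Bochner integral is 0 and the bound is
      trivial.\<close>
    proof (cases "integrable lborel (\<lambda>x. h x * G x)")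
      case True
      have "ennreal (LINT x|lborel. h x * G x) \<le> ennreal (norm (LINT x|lborel. h x * G x))" by (intro ennreal_leI) simp
      also have "\<dots> \<le> (\<integral>\<^sup>+ x. ennreal (norm (h x * G x)) \<partial>lborel)" by (rule integral_norm_bound_ennreal[OF True])
      also have "\<dots> \<le> (\<integral>\<^sup>+ x. ennreal \<bar>G x\<bar> \<partial>lborel)"
        using h by (intro nn_integral_mono ennreal_leI) (simp add: abs_mult mult_left_le_one_le)
      finally show ?thesis .
    qed (simp add: not_integrable_integral_eq)
    then have "ennreal (2 * C * v) * ennreal (LINT x|lborel. h x * G x) \<le> ennreal (2 * C * v) * (\<integral>\<^sup>+ x. ennreal \<bar>G x\<bar> \<partial>lborel)"
      by (rule mult_left_mono) simp
    then show ?thesis using C v by (simp add: ennreal_mult'[symmetric] mult_ac)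
  qed
  finally show ?thesis unfolding G_def .
qed

section \<open>Invariance under orthogonal maps\<close>

lemma measurable_orthogonal:
  fixes R :: "'a::euclidean_space \<Rightarrow> 'a"
  assumes "orthogonal_transformation R"
  shows "R \<in> borel_measurable borel"
  using orthogonal_transformation_linear[OF assms]
  by (intro borel_measurable_continuous_onI linear_continuous_on) (simp add: linear_conv_bounded_linear)

text \<open>
  As in the uniqueness proof for Haar measure, this follows from translation invariance and the radial symmetry of the heat kernel.
\<close>

lemma lborel_distr_orthogonal:
  fixes R :: "'a::euclidean_space \<Rightarrow> 'a"
  assumes R: "orthogonal_transformation R"
  shows "distr lborel borel R = lborel"
proof -
  have lin: "linear R" and norm: "norm (R x) = norm x" for x
    using R orthogonal_transformation_linear orthogonal_transformation_norm by auto
  note [measurable] = measurable_orthogonal[OF R]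
  have kR: "heat_kernel 1 (R z - R x) = heat_kernel 1 (z - x)" for x z
    using norm[of "z - x"] lin by (simp add: heat_kernel_def linear_diff)
  have "(\<integral>\<^sup>+ x. f (R x) \<partial>lborel) = (\<integral>\<^sup>+ x. f x \<partial>lborel)" if [measurable]: "f \<in> borel_measurable borel" for f :: "'a \<Rightarrow> ennreal"
  proof -
    have k1: "(\<integral>\<^sup>+ y. ennreal (heat_kernel 1 (y::'a)) \<partial>lborel) = 1" using nn_integral_heat_kernel(2)[of 1 "0::'a"] by simp
    \<comment> \<open>The factor 1 is inserted as the mass of the kernel. Adding
      \<open>y = R z\<close> to \<open>R x\<close> amounts to translating \<open>x\<close> by
      \<open>z\<close>; after the exchange the kernel integrates to 1 in \<open>x\<close> because
      \<open>kR\<close> removes \<open>R\<close> from its argument.\<close>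
    have "(\<integral>\<^sup>+ x. f (R x) \<partial>lborel) = (\<integral>\<^sup>+ y. ennreal (heat_kernel 1 (y::'a)) * (\<integral>\<^sup>+ x. f (R x) \<partial>lborel) \<partial>lborel)"
      using k1 by (simp add: nn_integral_multc)
    also have "\<dots> = (\<integral>\<^sup>+ y. ennreal (heat_kernel 1 y) * (\<integral>\<^sup>+ x. f (R x + y) \<partial>lborel) \<partial>lborel)"
    proof (rule nn_integral_cong)
      fix y :: 'a
      obtain z where "y = R z" using orthogonal_transformation_surj[OF R] by (metis surjD)
      then have "(\<integral>\<^sup>+ x. f (R x) \<partial>lborel) = (\<integral>\<^sup>+ x. f (R x + y) \<partial>lborel)"
        using nn_integral_lborel_translate[of "\<lambda>x. f (R x)" z] lin by (simp add: linear_add)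
      then show "ennreal (heat_kernel 1 y) * (\<integral>\<^sup>+ x. f (R x) \<partial>lborel) = ennreal (heat_kernel 1 y) * (\<integral>\<^sup>+ x. f (R x + y) \<partial>lborel)"
        by (simp only:)
    qed
    also have "\<dots> = (\<integral>\<^sup>+ y. \<integral>\<^sup>+ x. ennreal (heat_kernel 1 y) * f (R x + y) \<partial>lborel \<partial>lborel)"
      by (simp add: nn_integral_cmult)
    also have "\<dots> = (\<integral>\<^sup>+ x. \<integral>\<^sup>+ y. ennreal (heat_kernel 1 y) * f (R x + y) \<partial>lborel \<partial>lborel)"
      by (rule lborel_pair.Fubini') measurable
    also have "\<dots> = (\<integral>\<^sup>+ x. \<integral>\<^sup>+ y. ennreal (heat_kernel 1 (y - R x)) * f y \<partial>lborel \<partial>lborel)"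
    proof (rule nn_integral_cong)
      fix x
      show "(\<integral>\<^sup>+ y. ennreal (heat_kernel 1 y) * f (R x + y) \<partial>lborel) = (\<integral>\<^sup>+ y. ennreal (heat_kernel 1 (y - R x)) * f y \<partial>lborel)"
        using nn_integral_lborel_translate[of "\<lambda>y. ennreal (heat_kernel 1 (y - R x)) * f y" "R x"] by (simp add: add.commute)
    qed
    also have "\<dots> = (\<integral>\<^sup>+ y. \<integral>\<^sup>+ x. ennreal (heat_kernel 1 (y - R x)) * f y \<partial>lborel \<partial>lborel)"
      by (rule lborel_pair.Fubini') measurable
    also have "\<dots> = (\<integral>\<^sup>+ y. f y \<partial>lborel)"
    proof (rule nn_integral_cong)
      fix y
      obtain z where "y = R z" using orthogonal_transformation_surj[OF R] by (metis surjD)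
      then show "(\<integral>\<^sup>+ x. ennreal (heat_kernel 1 (y - R x)) * f y \<partial>lborel) = f y"
        using nn_integral_heat_kernel(1)[of 1 z] by (simp add: nn_integral_multc kR)
    qed
    finally show ?thesis .
  qed
  then have inv: "(\<integral>\<^sup>+ x. indicator A (R x) \<partial>lborel) = (\<integral>\<^sup>+ x. indicator A x \<partial>lborel)" if "A \<in> sets borel" for A
    using that by (simp add: borel_measurable_indicator)
  show ?thesis
  proof (rule measure_eqI)
    fix A assume "A \<in> sets (distr lborel borel R)"
    then have A [measurable]: "A \<in> sets borel" by simp
    have "emeasure (distr lborel borel R) A = (\<integral>\<^sup>+ x. indicator A x \<partial>distr lborel borel R)" by simp
    also have "\<dots> = (\<integral>\<^sup>+ x. indicator A (R x) \<partial>lborel)" by (rule nn_integral_distr) measurable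
    also have "\<dots> = emeasure lborel A" using inv[OF A] by simp
    finally show "emeasure (distr lborel borel R) A = emeasure lborel A" .
  qed simp
qed

lemma heat_orthogonal:
  fixes R :: "'a::euclidean_space \<Rightarrow> 'a" and f :: "'a \<Rightarrow> real"
  assumes R: "orthogonal_transformation R" and [measurable]: "f \<in> borel_measurable borel"
  shows "heat s (\<lambda>x. f (R x)) x = heat s f (R x)"
proof -
  have lin: "linear R" and norm: "norm (R x) = norm x" for x
    using R orthogonal_transformation_linear orthogonal_transformation_norm by auto
  note [measurable] = measurable_orthogonal[OF R]
  have "heat_kernel s (x - y) = heat_kernel s (R x - R y)" for y
    using norm[of "x - y"] lin by (simp add: heat_kernel_def linear_diff)
  then have "heat s (\<lambda>x. f (R x)) x = (LINT y|lborel. heat_kernel s (R x - R y) *\<^sub>R f (R y))"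
    by (simp add: heat_def)
  also have "\<dots> = heat s f (R x)"
    unfolding heat_def by (subst (2) lborel_distr_orthogonal[OF R, symmetric]) (simp add: integral_distr)
  finally show ?thesis .
qed

lemma nonneg_L2_orthogonal:
  fixes R :: "'a::euclidean_space \<Rightarrow> 'a"
  assumes R: "orthogonal_transformation R" and f: "nonneg_L2 f"
  shows "nonneg_L2 (\<lambda>x. f (R x))"
proof -
  note [measurable] = nonneg_L2D(1)[OF f] measurable_orthogonal[OF R]
  have "integrable (distr lborel borel R) (\<lambda>x. (f x)\<^sup>2)"
    unfolding lborel_distr_orthogonal[OF R] by (rule nonneg_L2D(3)[OF f])
  then have "integrable lborel (\<lambda>x. (f (R x))\<^sup>2)"
    by (subst (asm) integrable_distr_eq) auto
  then show ?thesis using nonneg_L2D(2)[OF f] by (simp add: nonneg_L2_def)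
qed

text \<open>The symmetry of the potential enters here: \<open>R\<close> preserves the ball, and
  \<open>heat\<close> commutes with composition by \<open>R\<close>.\<close>

lemma mollified_eigenequation_orthogonal:
  fixes R :: "'a::euclidean_space \<Rightarrow> 'a" and f :: "'a \<Rightarrow> real"
  assumes R: "orthogonal_transformation R" and [measurable]: "f \<in> borel_measurable borel"
    and eq: "mollified_eigenequation m \<alpha> C l (ball 0 a) v s f"
  shows "mollified_eigenequation m \<alpha> C l (ball 0 a) v s (\<lambda>x. f (R x))"
proof -
  have [measurable]: "ball (0::'a) a \<in> sets borel" by simp
  have "(\<lambda>z. indicator (ball 0 a) z * f (R z)) = (\<lambda>z. (\<lambda>z. indicator (ball 0 a) z * f z) (R z))"
    using orthogonal_transformation_norm[OF R] by (auto simp: indicator_def)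
  then have "heat s (\<lambda>z. indicator (ball 0 a) z * f (R z)) x = heat s (\<lambda>z. indicator (ball 0 a) z * f z) (R x)" for x
    by (simp only:) (rule heat_orthogonal[OF R], measurable)
  then show ?thesis
    using eq heat_orthogonal[OF R, of f] unfolding mollified_eigenequation_def by simp
qed

section \<open>From the ground state to proportionality\<close>

lemma continuous_AE_eq:
  fixes f g :: "'a::euclidean_space \<Rightarrow> real"
  assumes "continuous_on UNIV f" "continuous_on UNIV g" "AE x in lborel. f x = g x"
  shows "f x = g x"
proof (rule ccontr)
  let ?S = "{x. f x \<noteq> g x}"
  assume "f x \<noteq> g x"
  then have "?S \<noteq> {}" by auto
  moreover have "open ?S" by (rule open_Collect_neq[OF assms(1,2)])
  moreover from \<open>open ?S\<close> assms(3) have "?S \<in> null_sets lborel"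
    by (subst (asm) AE_iff_null) auto
  then have "negligible ?S"
    by (simp add: negligible_iff_null_sets null_sets_completionI)
  ultimately show False using open_not_negligible by blast
qed

text \<open>The graph of \<open>H_op\<close> gives \<open>g = (l + v 1\<^sub>B) \<phi>\<close> only
  almost everywhere and for complex functions. Heat averages ignore null sets, so the mollified
  equation is a real identity valid at every point.\<close>

lemma ground_state_mollified:
  fixes \<phi> :: "'a::euclidean_space \<Rightarrow> real"
  assumes par: "0 < \<alpha>" "0 \<le> m"
    and C: "0 < C" "\<And>z. 0 \<le> z \<Longrightarrow>
      (\<integral>\<^sup>+ t. ennreal (levy_density m \<alpha> t * (1 - exp (- z * t))) \<partial>lborel) = ennreal (C * Phi m \<alpha> z)"
    and H: "((\<lambda>x. complex_of_real (\<phi> x)), \<lambda>x. complex_of_real l * complex_of_real (\<phi> x)) \<in> H_op m \<alpha> v a"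
    and pos: "\<And>x. 0 \<le> \<phi> x"
  shows "nonneg_L2 \<phi>" and "0 < s \<Longrightarrow> mollified_eigenequation m \<alpha> C l (ball 0 a) v s \<phi>"
proof -
  let ?\<phi> = "\<lambda>x. complex_of_real (\<phi> x)"
  let ?B = "ball (0::'a) a"
  have [measurable]: "?B \<in> sets borel" by simp
  from H obtain g F where f: "is_fourier_L2 ?\<phi> F" and g: "is_fourier_L2 g (\<lambda>y. complex_of_real (Phi m \<alpha> ((norm y)\<^sup>2)) * F y)"
    and AE: "AE x in lborel. complex_of_real l * ?\<phi> x = g x - complex_of_real v * indicator ?B x * ?\<phi> x"
    by (auto simp: H_op_def L_op_def fourier_multiplier_def)
  from f have \<phi>c: "?\<phi> \<in> borel_measurable lborel" and \<phi>2: "integrable lborel (\<lambda>x. (\<phi> x)\<^sup>2)"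
    by (auto simp: is_fourier_L2_def L2_def)
  have "(\<lambda>x. Re (?\<phi> x)) \<in> borel_measurable lborel" using \<phi>c by measurable
  then have [measurable]: "\<phi> \<in> borel_measurable borel" by simp
  show L2: "nonneg_L2 \<phi>" using pos \<phi>2 by (simp add: nonneg_L2_def)
  from g have [measurable]: "g \<in> borel_measurable borel" by (simp add: is_fourier_L2_def L2_def)
  show "mollified_eigenequation m \<alpha> C l ?B v s \<phi>" if s: "0 < s"
    unfolding mollified_eigenequation_def
  proof
    fix x
    have h: "heat s ?\<phi> x = complex_of_real (heat s \<phi> x)" for s
      unfolding heat_def by (simp add: scaleR_conv_of_real flip: of_real_mult integral_complex_of_real)
    have "heat s g x = (LINT y|lborel. complex_of_real (l * (heat_kernel s (x - y) * \<phi> y) + v * (heat_kernel s (x - y) * (indicator ?B y * \<phi> y))))"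
      unfolding heat_def
    proof (rule integral_cong_AE)
      show "AE y in lborel. heat_kernel s (x - y) *\<^sub>R g y = complex_of_real (l * (heat_kernel s (x - y) * \<phi> y) + v * (heat_kernel s (x - y) * (indicator ?B y * \<phi> y)))"
        using AE
      proof eventually_elim
        case (elim y)
        then have "g y = complex_of_real (l * \<phi> y + v * (indicator ?B y * \<phi> y))"
          by (auto simp: algebra_simps indicator_def split: if_splits)
        then show ?case by (simp add: scaleR_conv_of_real algebra_simps)
      qed
    qed measurable
    also have "\<dots> = complex_of_real (l * heat s \<phi> x + v * heat s (\<lambda>z. indicator ?B z * \<phi> z) x)"
      unfolding integral_complex_of_real heat_def
      using integrable_heat_real[OF s L2, of x] integrable_heat_real[OF s nonneg_L2_indicator[OF L2 \<open>?B \<in> sets borel\<close>], of x]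
      by simp
    finally have hg: "heat s g x = complex_of_real (l * heat s \<phi> x + v * heat s (\<lambda>z. indicator ?B z * \<phi> z) x)" .
    have re: "levy_density m \<alpha> t *\<^sub>R (heat s ?\<phi> x - heat (s + t) ?\<phi> x) = complex_of_real (levy_density m \<alpha> t * (heat s \<phi> x - heat (s + t) \<phi> x))" for t
      by (simp add: h scaleR_conv_of_real)
    note eq = levy_equation[OF par C f g s, of x, unfolded re integral_complex_of_real complex_of_real_integrable_eq hg]
    show "integrable lborel (\<lambda>t. levy_density m \<alpha> t * (heat s \<phi> x - heat (s + t) \<phi> x)) \<and>
      (LINT t|lborel. levy_density m \<alpha> t * (heat s \<phi> x - heat (s + t) \<phi> x)) =
       C * (l * heat s \<phi> x + v * heat s (\<lambda>z. indicator ?B z * \<phi> z) x)"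
      using eq by (simp only: scaleR_conv_of_real of_real_eq_iff flip: of_real_mult)
  qed
qed

text \<open>The energy of \<open>f\<close> and \<open>g\<close> themselves is below every positive
  bound, hence 0. Density and kernel are strictly positive for \<open>t > 0\<close>, so
  \<open>f x * g y - g x * f y\<close> vanishes almost everywhere, and by continuity
  everywhere.\<close>

lemma mollified_eigenequation_proportional:
  fixes f g :: "'a::euclidean_space \<Rightarrow> real"
  assumes fin: "\<And>z. 0 \<le> z \<Longrightarrow> (\<integral>\<^sup>+ t. ennreal (levy_density m \<alpha> t * (1 - exp (- z * t))) \<partial>lborel) < \<infinity>"
    and C: "0 < C" and v: "0 < v"
    and cf: "continuous_on UNIV f" and cg: "continuous_on UNIV g" and f: "nonneg_L2 f" and g: "nonneg_L2 g"
    and fpos: "\<And>x. 0 < f x" and gpos: "\<And>x. 0 < g x"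
    and ef: "\<And>s. 0 < s \<Longrightarrow> mollified_eigenequation m \<alpha> C l (ball 0 a) v s f" 
    and eg: "\<And>s. 0 < s \<Longrightarrow> mollified_eigenequation m \<alpha> C l (ball 0 a) v s g"
  shows "f x * g y = g x * f y"
proof -
  note [measurable] = nonneg_L2D(1)[OF f] nonneg_L2D(1)[OF g] measurable_heat_pair
  define s where "s n = 1 / real (Suc n)" for n
  have s: "0 < s n" for n by (simp add: s_def)
  have slim: "filterlim s (at_right 0) sequentially" unfolding s_def by real_asymp
  define D where "D s = (\<integral>\<^sup>+ x. ennreal \<bar>heat s g x * heat s (\<lambda>z. indicator (ball 0 a) z * f z) x - 
     heat s f x * heat s (\<lambda>z. indicator (ball 0 a) z * g z) x\<bar> \<partial>lborel)" for s
  define u where "u n t x y = ennreal (levy_density m \<alpha> t * (heat_kernel t (x - y) * energy_density (heat (s n) f) (heat (s n) g) x y))" for n t x y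
  define w where "w t x y = ennreal (levy_density m \<alpha> t * (heat_kernel t (x - y) * energy_density f g x y))" for t x y
  have lim: "(\<lambda>n. u n t x y) \<longlonglongrightarrow> w t x y" for t x y
  proof -
    have hf: "(\<lambda>n. heat (s n) f x) \<longlonglongrightarrow> f x" and hg: "(\<lambda>n. heat (s n) g x) \<longlonglongrightarrow> g x" for x
      using filterlim_compose[OF heat_tendsto[OF cf f] slim] filterlim_compose[OF heat_tendsto[OF cg g] slim] by auto
    have "(f x + g x) * (f y + g y) \<noteq> 0" using fpos[of x] fpos[of y] gpos[of x] gpos[of y] by simp
    then show ?thesis unfolding u_def w_def energy_density_def
      by (intro tendsto_ennrealI tendsto_mult tendsto_const tendsto_divide tendsto_power tendsto_diff tendsto_add hf hg)
  qed
  \<comment> \<open>The energy is an iterated integral, so Fatou is applied once per variable,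
    innermost first.\<close>
  have "(\<integral>\<^sup>+ t. \<integral>\<^sup>+ x. \<integral>\<^sup>+ y. w t x y \<partial>lborel \<partial>lborel \<partial>lborel) = (\<integral>\<^sup>+ t. \<integral>\<^sup>+ x. \<integral>\<^sup>+ y. liminf (\<lambda>n. u n t x y) \<partial>lborel \<partial>lborel \<partial>lborel)"
    by (simp add: lim_imp_Liminf[OF _ lim])
  also have "\<dots> \<le> (\<integral>\<^sup>+ t. \<integral>\<^sup>+ x. liminf (\<lambda>n. \<integral>\<^sup>+ y. u n t x y \<partial>lborel) \<partial>lborel \<partial>lborel)"
    by (intro nn_integral_mono nn_integral_liminf; unfold u_def; measurable)
  also have "\<dots> \<le> (\<integral>\<^sup>+ t. liminf (\<lambda>n. \<integral>\<^sup>+ x. \<integral>\<^sup>+ y. u n t x y \<partial>lborel \<partial>lborel) \<partial>lborel)"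
    by (intro nn_integral_mono nn_integral_liminf; unfold u_def; measurable)
  also have "\<dots> \<le> liminf (\<lambda>n. \<integral>\<^sup>+ t. \<integral>\<^sup>+ x. \<integral>\<^sup>+ y. u n t x y \<partial>lborel \<partial>lborel \<partial>lborel)"
    by (intro nn_integral_liminf; unfold u_def; measurable)
  finally have fatou: "(\<integral>\<^sup>+ t. \<integral>\<^sup>+ x. \<integral>\<^sup>+ y. w t x y \<partial>lborel \<partial>lborel \<partial>lborel) \<le> liminf (\<lambda>n. \<integral>\<^sup>+ t. \<integral>\<^sup>+ x. \<integral>\<^sup>+ y. u n t x y \<partial>lborel \<partial>lborel \<partial>lborel)" .
  \<comment> \<open>The form \<open>0 + ennreal e\<close> is the premise of
    \<open>ennreal_le_epsilon\<close>.\<close>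
  have le: "(\<integral>\<^sup>+ t. \<integral>\<^sup>+ x. \<integral>\<^sup>+ y. w t x y \<partial>lborel \<partial>lborel \<partial>lborel) \<le> 0 + ennreal e" if e: "0 < e" for e
  proof -
    have "\<forall>\<^sub>F s in at_right 0. D s \<le> ennreal (e / (2 * C * v))"
      unfolding D_def using e C v by (intro commutator_eventually_le cf cg f g) auto
    then have "\<forall>\<^sub>F n in sequentially. D (s n) \<le> ennreal (e / (2 * C * v))"
      by (rule eventually_compose_filterlim[OF _ slim])
    then have "\<forall>\<^sub>F n in sequentially. (\<integral>\<^sup>+ t. \<integral>\<^sup>+ x. \<integral>\<^sup>+ y. u n t x y \<partial>lborel \<partial>lborel \<partial>lborel) \<le> ennreal e"
    proof eventually_elim
      case (elim n)
      have "(\<integral>\<^sup>+ t. \<integral>\<^sup>+ x. \<integral>\<^sup>+ y. u n t x y \<partial>lborel \<partial>lborel \<partial>lborel) \<le> ennreal (2 * C * v) * D (s n)"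
        unfolding u_def D_def using C v s
        by (intro energy_le_commutator[where l = l] fin f g ef eg) auto
      also have "\<dots> \<le> ennreal (2 * C * v) * ennreal (e / (2 * C * v))"
        using elim by (rule mult_left_mono) simp
      also have "\<dots> = ennreal e" using C v e by (simp add: ennreal_mult[symmetric])
      finally show ?case .
    qed
    then have "liminf (\<lambda>n. \<integral>\<^sup>+ t. \<integral>\<^sup>+ x. \<integral>\<^sup>+ y. u n t x y \<partial>lborel \<partial>lborel \<partial>lborel) \<le> liminf (\<lambda>n. ennreal e)"
      by (rule Liminf_mono)
    also have "\<dots> = ennreal e" by (simp add: Liminf_const)
    finally show ?thesis using fatou by simp
  qed
  have "(\<integral>\<^sup>+ t. \<integral>\<^sup>+ x. \<integral>\<^sup>+ y. w t x y \<partial>lborel \<partial>lborel \<partial>lborel) \<le> 0"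
    by (rule ennreal_le_epsilon) (rule le)
  then have "(\<integral>\<^sup>+ t. \<integral>\<^sup>+ x. \<integral>\<^sup>+ y. w t x y \<partial>lborel \<partial>lborel \<partial>lborel) = 0"
    by simp
  then have "AE t in lborel. (\<integral>\<^sup>+ x. \<integral>\<^sup>+ y. w t x y \<partial>lborel \<partial>lborel) = 0"
    by (subst nn_integral_0_iff_AE[symmetric]) (unfold w_def, measurable)
  \<comment> \<open>A single time \<open>t > 0\<close> is enough, because
    \<open>heat_kernel t\<close> is positive for every pair of points. It exists since the positive
    half-line is not a null set.\<close>
  moreover have "\<not> (AE t in lborel. \<not> 0 < (t::real))"
  proof
    assume "AE t in lborel. \<not> 0 < (t::real)"
    then have "{0<..} \<in> null_sets (lborel :: real measure)"
      by (subst (asm) AE_iff_null) (auto simp: greaterThan_def)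
    then have "negligible {0::real<..}" by (simp add: negligible_iff_null_sets null_sets_completionI)
    then show False using open_not_negligible[OF open_greaterThan, of "0::real"] by (metis empty_iff greaterThan_iff zero_less_one)
  qed
  ultimately obtain t where t: "0 < t" "(\<integral>\<^sup>+ x. \<integral>\<^sup>+ y. w t x y \<partial>lborel \<partial>lborel) = 0"
    by (metis (mono_tags, lifting) AE_mp AE_I2)
  from t(2) have "AE x in lborel. (\<integral>\<^sup>+ y. w t x y \<partial>lborel) = 0"
    by (subst nn_integral_0_iff_AE[symmetric]) (unfold w_def, measurable)
  \<comment> \<open>For almost every \<open>x\<close>, continuity in the second variable removes the
    exceptional set of \<open>y\<close>; afterwards continuity in the first removes that of
    \<open>x\<close>.\<close>
  then have "AE x in lborel. f x * g y = g x * f y"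
  proof eventually_elim
    case (elim x)
    then have "AE y in lborel. w t x y = 0"
      by (subst nn_integral_0_iff_AE[symmetric]) (unfold w_def, measurable)
    then have "AE y in lborel. f x * g y = g x * f y"
    proof eventually_elim
      case (elim y)
      have "0 < levy_density m \<alpha> t * heat_kernel t (x - y)"
        using t(1) heat_kernel_pos[OF t(1), of "x - y"] by (simp add: levy_density_def)
      moreover have "levy_density m \<alpha> t * heat_kernel t (x - y) * energy_density f g x y \<le> 0"
        using elim by (simp add: w_def ennreal_eq_0_iff mult.assoc)
      moreover have "0 \<le> energy_density f g x y" using fpos gpos by (intro energy_density_nonneg less_imp_le)
      ultimately have "energy_density f g x y = 0"
        by (metis mult_pos_pos not_le order.not_eq_order_implies_strict)
      then show ?case using fpos[of x] fpos[of y] gpos[of x] gpos[of y] by (simp add: energy_density_def)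
    qed
    then show ?case
      by (intro continuous_AE_eq[where x = y]) (auto intro!: continuous_intros cf cg)
  qed
  then show ?thesis
    by (intro continuous_AE_eq[where x = x]) (auto intro!: continuous_intros cf cg)
qed

theorem theorem4p1:
  fixes \<alpha> m v a :: real and \<phi>\<^sub>0 :: "real ^ 'n \<Rightarrow> real"
  assumes "0 < \<alpha>" and "\<alpha> < 2" and "0 \<le> m" and "0 < v" and "0 < a"
    and "normalized_ground_state (H_op m \<alpha> v a) \<phi>\<^sub>0"
  shows "\<forall>R x. rotation_matrix R \<longrightarrow> \<phi>\<^sub>0 (R *v x) = \<phi>\<^sub>0 x"
proof (intro allI impI)
  fix R :: "real ^ 'n ^ 'n" and x :: "real ^ 'n"
  assume "rotation_matrix R"
  then have R: "orthogonal_transformation ((*v) R)"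
    by (simp add: rotation_matrix_def orthogonal_transformation_matrix matrix_of_matrix_vector_mul)
  obtain C where C: "0 < C" "\<And>z. 0 \<le> z \<Longrightarrow>
      (\<integral>\<^sup>+ t. ennreal (levy_density m \<alpha> t * (1 - exp (- z * t))) \<partial>lborel) = ennreal (C * Phi m \<alpha> z)"
    using Phi_levy_density[of \<alpha> m] assms by blast
  define l where "l = inf_spectrum (H_op m \<alpha> v a :: (real ^ 'n) operator)"
  have cont: "continuous_on UNIV \<phi>\<^sub>0" and pos: "\<And>x. 0 < \<phi>\<^sub>0 x"
    and H: "((\<lambda>x. complex_of_real (\<phi>\<^sub>0 x)), \<lambda>x. complex_of_real l * complex_of_real (\<phi>\<^sub>0 x)) \<in> H_op m \<alpha> v a"
    using assms(6) by (auto simp: normalized_ground_state_def ground_state_def l_def)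
  have L2: "nonneg_L2 \<phi>\<^sub>0"
    by (rule ground_state_mollified(1)[OF assms(1,3) C H]) (use pos in \<open>auto intro: less_imp_le\<close>)
  have eq: "mollified_eigenequation m \<alpha> C l (ball 0 a) v s \<phi>\<^sub>0" if "0 < s" for s
    by (rule ground_state_mollified(2)[OF assms(1,3) C H]) (use pos that in \<open>auto intro: less_imp_le\<close>)
  \<comment> \<open>The second point is taken to be 0, which \<open>R\<close> fixes, so the constant
    of proportionality is 1.\<close>
  have "\<phi>\<^sub>0 (R *v x) * \<phi>\<^sub>0 0 = \<phi>\<^sub>0 x * \<phi>\<^sub>0 (R *v 0)"
  proof (rule mollified_eigenequation_proportional[where f = "\<lambda>x. \<phi>\<^sub>0 (R *v x)" and g = \<phi>\<^sub>0])
    show "continuous_on UNIV (\<lambda>x. \<phi>\<^sub>0 (R *v x))"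
      by (rule continuous_on_compose2[OF cont]) (auto intro: matrix_vector_mult_linear_continuous_on)
    show "nonneg_L2 (\<lambda>x. \<phi>\<^sub>0 (R *v x))" by (rule nonneg_L2_orthogonal[OF R L2])
    show "mollified_eigenequation m \<alpha> C l (ball 0 a) v s (\<lambda>x. \<phi>\<^sub>0 (R *v x))" if "0 < s" for s
      by (rule mollified_eigenequation_orthogonal[OF R nonneg_L2D(1)[OF L2] eq[OF that]])
    show "(\<integral>\<^sup>+ t. ennreal (levy_density m \<alpha> t * (1 - exp (- z * t))) \<partial>lborel) < \<infinity>" if "0 \<le> z" for z
      using C(2)[OF that] by simp
  qed (use cont pos L2 eq assms C in auto)
  then show "\<phi>\<^sub>0 (R *v x) = \<phi>\<^sub>0 x" using pos[of 0] by simp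
qed

end
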